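(* Let $\beta\in(1,3/2)$ and let $R=\{\tau_1,\ldots,\tau_6;p_1,\ldots,p_6\}$ be the random map described in the context. Then $R$ admits an absolutely continuous invariant measure, i.e. there is a probability measure $\mu$ on $S_\beta$, absolutely continuous with respect to Lebesgue measure, such that $\mu(A)=\sum_{k=1}^6 p_k\,\mu(\tau_k^{-1}(A))$ for every Borel set $A\subseteq S_\beta$.
   Context: $\vec q_0=(0,0)$, $\vec q_1=(1,0)$, $\vec q_2=(0,1)$; $S_\beta$ is the attractor of the IFS $f_{\vec q_i}(\vec z)=(\vec z+\vec q_i)/\beta$, which for $1<\beta<3/2$ is the closed triangle with vertices $(0,0)$, $(\frac1{\beta-1},0)$, $(0,\frac1{\beta-1})$. Subsets of $S_\beta$: $E_0=[0,\frac1\beta)\times[0,\frac1\beta)$; $E_1=\{0\le y<\frac1\beta,\ \frac{1}{\beta(\beta-1)}<x+y\le\frac{1}{\beta-1}\}$; $E_2=\{0\le x<\frac1\beta,\ \frac{1}{\beta(\beta-1)}<x+y\le\frac{1}{\beta-1}\}$; $C_{01}=\{x\ge\frac1\beta,\ 0\le y<\frac1\beta,\ x+y\le\frac{1}{\beta(\beta-1)}\}$; $C_{12}=\{x\ge\frac1\beta,\ y\ge\frac1\beta,\ \frac{1}{\beta(\beta-1)}<x+y\le\frac{1}{\beta-1}\}$; $C_{02}=\{0\le x<\frac1\beta,\ y\ge\frac1\beta,\ x+y\le\frac{1}{\beta(\beta-1)}\}$; $C_{012}=\{x\ge\frac1\beta,\ y\ge\frac1\beta,\ x+y\le\frac{1}{\beta(\beta-1)}\}$.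 For $k=1,\ldots,6$ define $\tau_k:S_\beta\to S_\beta$ by $\tau_k(\vec z)=\beta\vec z-a_k(\vec z)$, where: $a_k(\vec z)=\vec q_i$ for $\vec z\in E_i$ (all $k$); for $\vec z\in C_{ij}$, $ij\in\{01,12,02\}$, $a_k(\vec z)=\vec q_i$ if $k\in\{1,2,3\}$ and $a_k(\vec z)=\vec q_j$ if $k\in\{4,5,6\}$; for $\vec z\in C_{012}$, $a_k(\vec z)=\vec q_0$ if $k\in\{1,4\}$, $\vec q_1$ if $k\in\{2,5\}$, $\vec q_2$ if $k\in\{3,6\}$. Fix parameters $p\in(0,1)$ and $s,t>0$ with $s+t<1$, and let the (constant) probabilities be $p_1=ps$, $p_2=pt$, $p_3=p(1-s-t)$, $p_4=(1-p)s$, $p_5=(1-p)t$, $p_6=(1-p)(1-s-t)$. The random map $R$ applies $\tau_k$ with probability $p_k$. *)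

theory Defs
  imports "HOL-Probability.Probability"
begin

definition qv :: "nat \<Rightarrow> real \<times> real" where
  "qv i = (if i = 0 then (0,0) else if i = 1 then (1,0) else (0,1))"

definition Sb :: "real \<Rightarrow> (real \<times> real) set" where
  "Sb \<beta> = {(x,y). 0 \<le> x \<and> 0 \<le> y \<and> x + y \<le> 1/(\<beta>-1)}"

definition E0 :: "real \<Rightarrow> (real \<times> real) set" where
  "E0 \<beta> = {(x,y). 0 \<le> x \<and> x < 1/\<beta> \<and> 0 \<le> y \<and> y < 1/\<beta>}"

definition E1 :: "real \<Rightarrow> (real \<times> real) set" where
  "E1 \<beta> = {(x,y). 0 \<le> y \<and> y < 1/\<beta> \<and> 1/(\<beta>*(\<beta>-1)) < x + y \<and> x + y \<le> 1/(\<beta>-1)}"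

definition E2 :: "real \<Rightarrow> (real \<times> real) set" where
  "E2 \<beta> = {(x,y). 0 \<le> x \<and> x < 1/\<beta> \<and> 1/(\<beta>*(\<beta>-1)) < x + y \<and> x + y \<le> 1/(\<beta>-1)}"

definition C01 :: "real \<Rightarrow> (real \<times> real) set" where
  "C01 \<beta> = {(x,y). x \<ge> 1/\<beta> \<and> 0 \<le> y \<and> y < 1/\<beta> \<and> x + y \<le> 1/(\<beta>*(\<beta>-1))}"

definition C12 :: "real \<Rightarrow> (real \<times> real) set" where
  "C12 \<beta> = {(x,y). x \<ge> 1/\<beta> \<and> y \<ge> 1/\<beta> \<and> 1/(\<beta>*(\<beta>-1)) < x + y \<and> x + y \<le> 1/(\<beta>-1)}"

definition C02 :: "real \<Rightarrow> (real \<times> real) set" where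
  "C02 \<beta> = {(x,y). 0 \<le> x \<and> x < 1/\<beta> \<and> y \<ge> 1/\<beta> \<and> x + y \<le> 1/(\<beta>*(\<beta>-1))}"

definition C012 :: "real \<Rightarrow> (real \<times> real) set" where
  "C012 \<beta> = {(x,y). x \<ge> 1/\<beta> \<and> y \<ge> 1/\<beta> \<and> x + y \<le> 1/(\<beta>*(\<beta>-1))}"

text \<open>The digit a_k(z), k = 1..6 (value outside S_beta is irrelevant; set to q0).\<close>
definition digit :: "real \<Rightarrow> nat \<Rightarrow> real \<times> real \<Rightarrow> real \<times> real" where
  "digit \<beta> k z =
    (if z \<in> E0 \<beta> then qv 0
     else if z \<in> E1 \<beta> then qv 1
     else if z \<in> E2 \<beta> then qv 2
     else if z \<in> C01 \<beta> then (if k \<in> {1,2,3} then qv 0 else qv 1)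
     else if z \<in> C12 \<beta> then (if k \<in> {1,2,3} then qv 1 else qv 2)
     else if z \<in> C02 \<beta> then (if k \<in> {1,2,3} then qv 0 else qv 2)
     else if z \<in> C012 \<beta> then
       (if k \<in> {1,4} then qv 0 else if k \<in> {2,5} then qv 1 else qv 2)
     else qv 0)"

definition tau :: "real \<Rightarrow> nat \<Rightarrow> real \<times> real \<Rightarrow> real \<times> real" where
  "tau \<beta> k z = \<beta> *\<^sub>R z - digit \<beta> k z"

definition pk :: "real \<Rightarrow> real \<Rightarrow> real \<Rightarrow> nat \<Rightarrow> real" where
  "pk p s t k =
    (if k = 1 then p * s else if k = 2 then p * t else if k = 3 then p * (1 - s - t)
     else if k = 4 then (1 - p) * s else if k = 5 then (1 - p) * t
     else if k = 6 then (1 - p) * (1 - s - t) else 0)"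

end

(*
  The random map has the transfer operator (P f)(z) = beta^(-2) * sum_i (w_i f)((z + q_i)/beta), where
  w_i(u) is the probability of the digit q_i at u.  Every branch is a homothety, and the w_i jump
  only across lines of the three directions x = c, y = c, x + y = c; preimages of such lines are
  lines of the same direction.  Let D_v(f) be the L1 distance of f and its translate by v.  A step
  of P replaces D_{he}(f) by D_{he/beta}(f) plus twice the mass of f in strips of width h/beta around the
  jump lines.  Pulled back n times these are strips of width h/beta^n around finitely many parallel
  lines, and a strip of width w has mass O(D_{2we}(f) + w).  Hence a bound D_{he}(f) <= V h for all h
  improves to D_{he}(P^n f) <= ((1 + 8 n) V + K_n) h / beta^n: although beta may be close to 1, beta^n outgrows
  1 + 8 n, so D_{he}(P^n f) <= V h with V independent of n.

  Consequently the averages A_n of the P^n f have truncations min(A_n, M) of mass at least 1/2.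
  Minimising the L2 norm over convex combinations yields nearly invariant densities g_n that dominate
  functions b_n converging almost everywhere to a limit of mass at least 1/2.  Then k = liminf g_n
  has positive finite mass and P k <= k almost everywhere; since P preserves mass, P k = k.
*)
theory Submission
  imports Defs
begin

text \<open>The obstacle is weak expansion: with \<beta> near 1, one application of P need not
  shrink the translation bound, and iterating the one-step estimate, or counting the jump lines of
  P^n, gives exponential factors that may beat \<beta>^n. Two points avoid this. The mass of f in
  strips around finitely many parallel lines is bounded by D_{2we}(f) with coefficient 1, however
  many lines there are; their number and spacing enter only the additive constant K_n, whose growth
  is harmless because it is needed only up to one fixed n. Moreover the strips that arise at each
  step are pulled back to the initial f, so a step adds 8V instead of multiplying V: a factor 2 for
  the change of the weights, 2 for the families of lines met when moving along an axis, and 2V for a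
  translate by twice the width. In the passage to the limit only the truncations are bounded in L2,
  but they are not nearly invariant, while the densities are nearly invariant but not bounded in L2.
  Hence convex combinations are formed of pairs, a bounded part together with the density above it.
  The bounded part keeps the lower limit from losing all its mass.\<close>

section \<open>Almost everywhere convergence\<close>

text \<open>The infima \<open>d n\<close> of the squared L2 norms increase to a finite limit, so by
  the parallelogram law near-minimisers taken at different stages are close to each other; choosing
  them fast enough yields pointwise convergence. This does the work of weak compactness in
  L2.\<close>

lemma midpoint_convex_AE_convergent:
  fixes K :: "nat \<Rightarrow> ('a \<Rightarrow> real) set"
  assumes ne: "\<And>n. K n \<noteq> {}" and dec: "decseq K"
    and meas: "\<And>n b. b \<in> K n \<Longrightarrow> b \<in> borel_measurable M"
    and int: "\<And>n b. b \<in> K n \<Longrightarrow> integrable M (\<lambda>x. (b x)\<^sup>2)"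
    and bd: "\<And>n b. b \<in> K n \<Longrightarrow> (\<integral>x. (b x)\<^sup>2 \<partial>M) \<le> c"
    and mid: "\<And>n b b'. b \<in> K n \<Longrightarrow> b' \<in> K n \<Longrightarrow> (\<lambda>x. (b x + b' x) / 2) \<in> K n"
  obtains b where "\<And>n. b n \<in> K n" "AE x in M. convergent (\<lambda>n. b n x)"
proof -
  define \<Phi> where "\<Phi> b = (\<integral>x. (b x)\<^sup>2 \<partial>M)" for b :: "'a \<Rightarrow> real"
  define d where "d n = Inf (\<Phi> ` K n)" for n
  have sub: "K n \<subseteq> K m" if "m \<le> n" for m n
    using dec that by (auto simp: decseq_def)
  have \<Phi>0: "0 \<le> \<Phi> b" for b
    unfolding \<Phi>_def by simp
  have bdd: "bdd_below (\<Phi> ` A)" for A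
    by (rule bdd_belowI[of _ 0]) (auto simp: \<Phi>0)
  have dle: "d n \<le> \<Phi> b" if "b \<in> K n" for n b
    unfolding d_def using that bdd by (auto intro: cInf_lower)
  have d_inc: "incseq d"
    unfolding incseq_def d_def using ne bdd sub by (intro allI impI cInf_superset_mono image_mono) auto
  have d_bd: "d n \<le> c" for n
  proof -
    obtain b where "b \<in> K n" using ne by blast
    then show ?thesis using dle bd unfolding \<Phi>_def by fastforce
  qed
  obtain L where L: "d \<longlonglongrightarrow> L"
    using incseq_convergent[OF d_inc, of c] d_bd by blast
  have dL: "d n \<le> L" for n
    using incseq_le[OF d_inc L] .
  \<comment> \<open>The rate 1/8 leaves room for the weights \<open>4^n\<close> used below, because
    \<open>4^n * (1/8)^n\<close> is still summable.\<close>
  have "\<exists>m. n \<le> m \<and> L - (1/8)^n < d m" for n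
  proof -
    have "eventually (\<lambda>m. L - (1/8)^n < d m) sequentially"
      using order_tendstoD(1)[OF L, of "L - (1/8)^n"] by simp
    then obtain N where "\<forall>m\<ge>N. L - (1/8)^n < d m" by (auto simp: eventually_sequentially)
    then show ?thesis by (intro exI[of _ "max n N"]) auto
  qed
  then obtain m where m: "\<And>n. n \<le> m n" "\<And>n. L - (1/8)^n < d (m n)" by metis
  \<comment> \<open>The running maximum makes the stages increase, so \<open>b (Suc n)\<close> also
    lies in \<open>K (N n)\<close> and the midpoint of two consecutive choices belongs to that
    set.\<close>
  define N where "N n = Max (m ` {..n})" for n
  have N_mono: "N n \<le> N (Suc n)" for n
    unfolding N_def by (rule Max_mono) auto
  have mN: "m n \<le> N n" for n unfolding N_def by (rule Max_ge) auto
  have Nn: "n \<le> N n" for n using mN[of n] m(1)[of n] by simp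
  have Nd: "L - (1/8)^n < d (N n)" for n
    using m(2)[of n] incseqD[OF d_inc mN[of n]] by simp
  have "\<exists>b\<in>K (N n). \<Phi> b < L + (1/8)^n" for n
  proof -
    have "d (N n) < L + (1/8)^n" using dL[of "N n"] by (smt (verit) zero_less_power divide_pos_pos)
    then show ?thesis unfolding d_def using cInf_lessD[of "\<Phi> ` K (N n)"] ne by fastforce
  qed
  then obtain b where b: "\<And>n. b n \<in> K (N n)" "\<And>n. \<Phi> (b n) < L + (1/8)^n" by metis
  have bi: "integrable M (\<lambda>x. (b n x)\<^sup>2)" and bm[measurable]: "b n \<in> borel_measurable M" for n
    using b(1) int meas by auto
  have step: "integrable M (\<lambda>x. (b n x - b (Suc n) x)\<^sup>2)"
    "(\<integral>x. (b n x - b (Suc n) x)\<^sup>2 \<partial>M) \<le> 8 * (1/8)^n" for n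
  proof -
    have K: "b n \<in> K (N n)" "b (Suc n) \<in> K (N n)"
      by (rule b(1), rule subsetD[OF sub[OF N_mono] b(1)])
    have mid': "(\<lambda>x. (b n x + b (Suc n) x) / 2) \<in> K (N n)" by (rule mid[OF K])
    have I: "integrable M (\<lambda>x. ((b n x + b (Suc n) x)/2)\<^sup>2)" using int[OF mid'] .
    have ge: "d (N n) \<le> (\<integral>x. ((b n x + b (Suc n) x)/2)\<^sup>2 \<partial>M)"
      using dle[OF mid'] unfolding \<Phi>_def .
    have eq: "(b n x - b (Suc n) x)\<^sup>2 = 2 * (b n x)\<^sup>2 + 2 * (b (Suc n) x)\<^sup>2 - 4 * ((b n x + b (Suc n) x)/2)\<^sup>2" for x
      by (simp add: power2_eq_square field_simps)
    show "integrable M (\<lambda>x. (b n x - b (Suc n) x)\<^sup>2)"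
      unfolding eq by (intro Bochner_Integration.integrable_diff Bochner_Integration.integrable_add integrable_mult_right bi I)
    have "(\<integral>x. (b n x - b (Suc n) x)\<^sup>2 \<partial>M) = 2 * \<Phi> (b n) + 2 * \<Phi> (b (Suc n)) - 4 * (\<integral>x. ((b n x + b (Suc n) x)/2)\<^sup>2 \<partial>M)"
      unfolding eq \<Phi>_def using bi I by simp
    also have "\<dots> \<le> 2 * (L + (1/8)^n) + 2 * (L + (1/8)^Suc n) - 4 * (L - (1/8)^n)"
      using b(2)[of n] b(2)[of "Suc n"] ge Nd[of n] by argo
    also have "\<dots> \<le> 8 * (1/8)^n" by simp
    finally show "(\<integral>x. (b n x - b (Suc n) x)\<^sup>2 \<partial>M) \<le> 8 * (1/8)^n" .
  qed
  \<comment> \<open>The weights turn the L2 estimate into a pointwise rate: where the weighted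
    series converges its terms are bounded, so consecutive differences are at most a constant times
    \<open>(1/2)^n\<close>.\<close>
  have "AE x in M. summable (\<lambda>n. 4^n * (b n x - b (Suc n) x)\<^sup>2)"
  proof -
    have "(\<integral>\<^sup>+x. (\<Sum>n. ennreal (4^n * (b n x - b (Suc n) x)\<^sup>2)) \<partial>M)
        = (\<Sum>n. \<integral>\<^sup>+x. ennreal (4^n * (b n x - b (Suc n) x)\<^sup>2) \<partial>M)"
      by (rule nn_integral_suminf) measurable
    also have "\<dots> \<le> (\<Sum>n. ennreal (8 * (1/2)^n))"
    proof (intro suminf_le summableI)
      fix n :: nat
      have e: "(4::real)^n * (1/8)^n = (1/2)^n" by (simp flip: power_mult_distrib)
      have "(\<integral>\<^sup>+x. ennreal (4^n * (b n x - b (Suc n) x)\<^sup>2) \<partial>M) = ennreal (\<integral>x. 4^n * (b n x - b (Suc n) x)\<^sup>2 \<partial>M)"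
        by (rule nn_integral_eq_integral) (use step(1) in auto)
      also have "\<dots> \<le> ennreal (8 * (1/2)^n)"
        using mult_left_mono[OF step(2)[of n], of "4^n"] e by (intro ennreal_leI) (simp add: algebra_simps)
      finally show "(\<integral>\<^sup>+x. ennreal (4^n * (b n x - b (Suc n) x)\<^sup>2) \<partial>M) \<le> ennreal (8 * (1/2)^n)" .
    qed
    also have "\<dots> < \<infinity>"
      using summable_mult[OF summable_geometric[of "1/2 :: real"], of 8] by (subst suminf_ennreal2) auto
    finally have "AE x in M. (\<Sum>n. ennreal (4^n * (b n x - b (Suc n) x)\<^sup>2)) \<noteq> \<infinity>"
      by (intro nn_integral_PInf_AE) (auto simp: less_top)
    then show ?thesis
      by eventually_elim (auto intro!: summable_suminf_not_top simp: top_ennreal_def)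
  qed
  then have "AE x in M. convergent (\<lambda>n. b n x)"
  proof eventually_elim
    case (elim x)
    then have "Bseq (\<lambda>n. 4^n * (b n x - b (Suc n) x)\<^sup>2)"
      by (intro convergent_imp_Bseq) (auto simp: convergent_def dest: summable_LIMSEQ_zero)
    then obtain C where C: "0 < C" "\<And>n. norm (4^n * (b n x - b (Suc n) x)\<^sup>2) \<le> C"
      unfolding Bseq_def by blast
    have le: "norm (b (Suc n) x - b n x) \<le> sqrt C * (1/2)^n" for n
    proof -
      have four: "((2::real)^n)\<^sup>2 = 4^n"
        by (simp add: power2_eq_square flip: power_mult_distrib)
      have "(2^n * \<bar>b n x - b (Suc n) x\<bar>)\<^sup>2 \<le> C"
        using C(2)[of n] four by (simp add: power_mult_distrib)
      then have "2^n * \<bar>b n x - b (Suc n) x\<bar> \<le> sqrt C"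
        by (rule real_le_rsqrt)
      then show ?thesis by (simp add: field_simps abs_minus_commute)
    qed
    have "summable (\<lambda>n. sqrt C * (1/2)^n)"
      by (rule summable_mult, rule summable_geometric) simp
    then have "summable (\<lambda>n. b (Suc n) x - b n x)"
      by (rule summable_comparison_test'[where N = 0]) (rule le)
    then have "convergent (\<lambda>n. \<Sum>k<n. b (Suc k) x - b k x)"
      by (simp add: summable_iff_convergent)
    then have "convergent (\<lambda>n. b n x - b 0 x)"
      using sum_lessThan_telescope[of "\<lambda>n. b n x"] by simp
    then have "convergent (\<lambda>n. (b n x - b 0 x) + b 0 x)"
      by (intro convergent_add convergent_const)
    then show ?case by simp
  qed
  moreover have "b n \<in> K n" for n by (rule subsetD[OF sub[OF Nn] b(1)])
  ultimately show thesis by (rule that[rotated])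
qed

text \<open>By Tonelli the series of absolute values has a finite integral, hence it converges
  almost everywhere and its terms tend to 0. This makes the summable L1 defects of the nearly
  invariant densities pointwise small.\<close>

lemma AE_tendsto_0_of_summable:
  fixes f :: "nat \<Rightarrow> 'a \<Rightarrow> real"
  assumes [measurable]: "\<And>n. f n \<in> borel_measurable M"
    and le: "\<And>n. (\<integral>\<^sup>+x. ennreal \<bar>f n x\<bar> \<partial>M) \<le> ennreal (a n)" and a: "summable a" "\<And>n. 0 \<le> a n"
  shows "AE x in M. (\<lambda>n. f n x) \<longlonglongrightarrow> 0"
proof -
  have "(\<integral>\<^sup>+x. (\<Sum>n. ennreal \<bar>f n x\<bar>) \<partial>M) = (\<Sum>n. \<integral>\<^sup>+x. ennreal \<bar>f n x\<bar> \<partial>M)"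
    by (rule nn_integral_suminf) measurable
  also have "\<dots> \<le> (\<Sum>n. ennreal (a n))"
    by (intro suminf_le summableI le)
  also have "\<dots> < \<infinity>"
    using a by (subst suminf_ennreal2) auto
  finally have "AE x in M. (\<Sum>n. ennreal \<bar>f n x\<bar>) \<noteq> \<infinity>"
    by (intro nn_integral_PInf_AE) (auto simp: less_top)
  then show ?thesis
  proof eventually_elim
    case (elim x)
    then have "summable (\<lambda>n. \<bar>f n x\<bar>)"
      by (intro summable_suminf_not_top) (auto simp: top_ennreal_def)
    then show ?case
      by (rule summable_LIMSEQ_zero[OF summable_rabs_cancel])
  qed
qed

text \<open>This is how near invariance is used: under a lower limit, transferred densities may be
  replaced by the densities themselves, even at points where that limit is infinite.\<close>

lemma liminf_ennreal_le_of_diff_tendsto_0: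
  fixes x y :: "nat \<Rightarrow> real"
  assumes x0: "\<And>n. 0 \<le> x n" and d: "(\<lambda>n. y n - x n) \<longlonglongrightarrow> 0"
  shows "liminf (\<lambda>n. ennreal (y n)) \<le> liminf (\<lambda>n. ennreal (x n))"
proof (rule ennreal_le_epsilon)
  fix e :: real assume e: "0 < e"
  have "eventually (\<lambda>n. y n - x n < e) sequentially"
    using order_tendstoD(2)[OF d e] .
  then have "eventually (\<lambda>n. ennreal (y n) \<le> ennreal (x n) + ennreal e) sequentially"
  proof eventually_elim
    case (elim n)
    then show ?case using x0[of n] e by (simp add: ennreal_leI flip: ennreal_plus)
  qed
  then have "liminf (\<lambda>n. ennreal (y n)) \<le> liminf (\<lambda>n. ennreal (x n) + ennreal e)"
    by (rule Liminf_mono)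
  also have "\<dots> = liminf (\<lambda>n. ennreal (x n)) + ennreal e"
    by (rule Liminf_add_const) auto
  finally show "liminf (\<lambda>n. ennreal (y n)) \<le> liminf (\<lambda>n. ennreal (x n)) + ennreal e" .
qed

lemma ennreal_midpoint:
  assumes "0 \<le> x" "0 \<le> y"
  shows "ennreal ((x + y) / 2) = ennreal (1/2) * (ennreal x + ennreal y)"
proof -
  have "ennreal (1/2) * (ennreal x + ennreal y) = ennreal (1/2) * ennreal (x + y)"
    using assms by (simp only: ennreal_plus)
  also have "\<dots> = ennreal (1/2 * (x + y))" using assms by (intro ennreal_mult[symmetric]) auto
  finally show ?thesis by (simp only: mult_1_left times_divide_eq_left)
qed

lemma ennreal_half_double: "ennreal (1/2) * (x + x) = x"
proof -
  have "ennreal (1/2) * (x + x) = (ennreal (1/2) + ennreal (1/2)) * x" by (simp only: distrib_left distrib_right)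
  also have "ennreal (1/2) + ennreal (1/2) = ennreal 1" by (subst ennreal_plus[symmetric]) auto
  finally show ?thesis by simp
qed

section \<open>Translation modulus and mass of strips\<close>

lemma coordinates_measurable [measurable]:
  "fst \<in> borel_measurable (borel :: (real \<times> real) measure)"
  "snd \<in> borel_measurable (borel :: (real \<times> real) measure)"
  by (intro borel_measurable_continuous_onI continuous_intros)+

lemma emeasure_lborel_cbox_pair:
  assumes "a \<le> c" "b \<le> (d::real)"
  shows "emeasure lborel (cbox (a, b) (c::real, d)) = ennreal ((c - a) * (d - b))"
  using assms by (subst emeasure_lborel_cbox) (auto simp: Basis_prod_def prod.union_disjoint)

lemma nn_integral_lborel_scale_shift:
  fixes g :: "'a::euclidean_space \<Rightarrow> ennreal"
  assumes [measurable]: "g \<in> borel_measurable borel" and c: "0 < c"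
  shows "(\<integral>\<^sup>+z. g z \<partial>lborel) = ennreal (c ^ DIM('a)) * (\<integral>\<^sup>+z. g (c *\<^sub>R z + t) \<partial>lborel)"
  using c by (subst lborel_affine[of c t])
    (auto simp: nn_integral_density nn_integral_distr nn_integral_cmult add.commute)

lemma nn_integral_lborel_shift:
  fixes g :: "'a::euclidean_space \<Rightarrow> ennreal"
  assumes "g \<in> borel_measurable borel"
  shows "(\<integral>\<^sup>+z. g (z + t) \<partial>lborel) = (\<integral>\<^sup>+z. g z \<partial>lborel)"
  using nn_integral_lborel_scale_shift[OF assms, of 1 t] by simp

text \<open>The modulus D_v(f) of the overview. A bound V h for the translates by h e, for all h >
  0, is the finite difference form of saying that f has directional variation at most V along e; no
  derivatives or distributions are involved.\<close>

definition shift_dist :: "'a::euclidean_space \<Rightarrow> ('a \<Rightarrow> real) \<Rightarrow> ennreal" where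
  "shift_dist v f = (\<integral>\<^sup>+z. ennreal \<bar>f (z + v) - f z\<bar> \<partial>lborel)"

lemma shift_dist_zero [simp]: "shift_dist 0 f = 0"
  by (simp add: shift_dist_def)

lemma shift_dist_add:
  fixes f :: "'a::euclidean_space \<Rightarrow> real"
  assumes [measurable]: "f \<in> borel_measurable borel"
  shows "shift_dist (u + v) f \<le> shift_dist u f + shift_dist v f"
proof -
  have "shift_dist (u + v) f \<le> (\<integral>\<^sup>+z. ennreal \<bar>f ((z + v) + u) - f (z + v)\<bar> + ennreal \<bar>f (z + v) - f z\<bar> \<partial>lborel)"
    unfolding shift_dist_def
    by (intro nn_integral_mono) (simp add: ac_simps flip: ennreal_plus)
  also have "\<dots> = (\<integral>\<^sup>+z. ennreal \<bar>f ((z + v) + u) - f (z + v)\<bar> \<partial>lborel) + shift_dist v f"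
    unfolding shift_dist_def by (rule nn_integral_add) measurable
  also have "(\<integral>\<^sup>+z. ennreal \<bar>f ((z + v) + u) - f (z + v)\<bar> \<partial>lborel) = shift_dist u f"
    unfolding shift_dist_def
    by (rule nn_integral_lborel_shift[where g = "\<lambda>z. ennreal \<bar>f (z + u) - f z\<bar>"]) measurable
  finally show ?thesis .
qed

text \<open>These are the points from which an increase of \<open>l\<close> by \<open>\<eta>\<close>
  reaches or crosses a level in \<open>C\<close>. The strip lies on one side of each level and is
  closed, so it contains every point whose translate falls on the other side.\<close>

definition strip :: "('a::euclidean_space \<Rightarrow> real) \<Rightarrow> real \<Rightarrow> real set \<Rightarrow> 'a set" where
  "strip l \<eta> C = {z. \<exists>c\<in>C. l z \<le> c \<and> c \<le> l z + \<eta>}"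

lemma strip_measurable [measurable]:
  assumes [measurable]: "l \<in> borel_measurable borel" and "finite C"
  shows "strip l \<eta> C \<in> sets borel"
proof -
  have "strip l \<eta> C = (\<Union>c\<in>C. {z. l z \<le> c \<and> c \<le> l z + \<eta>})" by (auto simp: strip_def)
  moreover have "{z. l z \<le> c \<and> c \<le> l z + \<eta>} \<in> sets borel" for c by measurable
  ultimately show ?thesis using assms(2) by auto
qed

section \<open>A bounded function detecting finitely many levels\<close>

lemma finite_real_separated:
  assumes "finite (C :: real set)"
  obtains \<delta> where "0 < \<delta>" "\<And>c c'. c \<in> C \<Longrightarrow> c' \<in> C \<Longrightarrow> c < c' \<Longrightarrow> \<delta> \<le> c' - c"
proof -
  let ?X = "(\<lambda>(c, c'). c' - c) ` {(c, c') \<in> C \<times> C. c < c'}"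
  have fin: "finite ?X"
    by (rule finite_imageI, rule finite_subset[of _ "C \<times> C"]) (use assms in auto)
  show thesis
  \<comment> \<open>The inserted 1 keeps the minimum defined when \<open>C\<close> has fewer than
    two points.\<close>
  proof (rule that[of "Min (insert 1 ?X)"])
    show "0 < Min (insert 1 ?X)" using fin by (subst Min_gr_iff) auto
    show "Min (insert 1 ?X) \<le> c' - c" if "c \<in> C" "c' \<in> C" "c < c'" for c c'
      using that fin by (intro Min_le) (auto intro!: image_eqI[of _ _ "(c, c')"])
  qed
qed

text \<open>
  The function \<open>\<phi>\<close> is a sawtooth that jumps from about 0 to 1 at every point of \<open>C\<close> and decreases
  linearly in between, so its increments over short intervals detect the points of \<open>C\<close> up to an
  error proportional to the length.
\<close>

lemma sawtooth:
  assumes "finite (C :: real set)"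
  obtains \<phi> :: "real \<Rightarrow> real" and K
  where "\<phi> \<in> borel_measurable borel" "\<And>x. 0 \<le> \<phi> x" "\<And>x. \<phi> x \<le> 1" "0 \<le> K"
    "\<And>x \<eta>. 0 < \<eta> \<Longrightarrow> of_bool (\<exists>c\<in>C. x \<le> c \<and> c \<le> x + \<eta>) + \<phi> (x - \<eta>) \<le> \<phi> (x + \<eta>) + K * \<eta>"
proof -
  obtain \<delta> where \<delta>: "0 < \<delta>" "\<And>c c'. c \<in> C \<Longrightarrow> c' \<in> C \<Longrightarrow> c < c' \<Longrightarrow> \<delta> \<le> c' - c"
    using finite_real_separated[OF assms] by blast
  \<comment> \<open>A single tooth: it jumps to 1 at 0 and has come down to 0 at
    \<open>\<delta>\<close>, the minimal gap, so teeth placed at different points of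
    \<open>C\<close> do not overlap.\<close>
  define s where "s t = (if 0 \<le> t \<and> t < \<delta> then 1 - t / \<delta> else 0)" for t
  have s_le: "s t \<le> a / \<delta>" if "\<delta> - t \<le> a" "0 \<le> a" for t a
    using that \<delta>(1) divide_right_mono[OF that(1), of \<delta>] by (auto simp: s_def diff_divide_distrib)
  have s01: "0 \<le> s t" "s t \<le> 1" for t
    using \<delta>(1) by (auto simp: s_def field_simps)
  define \<phi> where "\<phi> x = Max (insert 0 ((\<lambda>c. s (x - c)) ` C))" for x
  have fin: "finite (insert 0 ((\<lambda>c. s (x - c)) ` C))" for x using assms by simp
  have ge0: "0 \<le> \<phi> x" for x
    unfolding \<phi>_def using fin by (intro Max_ge) auto
  have ge: "s (x - c) \<le> \<phi> x" if "c \<in> C" for x c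
    unfolding \<phi>_def using fin that by (intro Max_ge) auto
  have le: "\<phi> x \<le> B" if "0 \<le> B" "\<And>c. c \<in> C \<Longrightarrow> s (x - c) \<le> B" for x B
    unfolding \<phi>_def using fin that by (subst Max_le_iff) auto
  have le1: "\<phi> x \<le> 1" for x using s01 by (intro le) auto
  have meas: "\<phi> \<in> borel_measurable borel"
  proof (cases "C = {}")
    case True
    then show ?thesis by (simp add: \<phi>_def[abs_def])
  next
    case False
    have [measurable]: "s \<in> borel_measurable borel" unfolding s_def[abs_def] by measurable
    have [measurable]: "(\<lambda>x. Max ((\<lambda>c. s (x - c)) ` C)) \<in> borel_measurable borel"
      using assms False by (intro borel_measurable_Max) measurable
    have "\<phi> = (\<lambda>x. max 0 (Max ((\<lambda>c. s (x - c)) ` C)))"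
      unfolding \<phi>_def[abs_def] using assms False by (subst Max_insert) auto
    then show ?thesis by simp
  qed
  show thesis
  proof (rule that[OF meas ge0 le1])
    show "0 \<le> 4 / \<delta>" using \<delta>(1) by simp
    fix x \<eta> :: real assume \<eta>: "0 < \<eta>"
    show "of_bool (\<exists>c\<in>C. x \<le> c \<and> c \<le> x + \<eta>) + \<phi> (x - \<eta>) \<le> \<phi> (x + \<eta>) + 4 / \<delta> * \<eta>"
    \<comment> \<open>For such long intervals the error term is at least 2 and the bounds 0 and 1 on
      \<open>\<phi>\<close> suffice.\<close>
    proof (cases "\<delta> \<le> 2 * \<eta>")
      case True
      then have "2 \<le> 4 / \<delta> * \<eta>" using \<delta>(1) by (simp add: field_simps)
      then show ?thesis
        using le1[of "x - \<eta>"] ge0[of "x + \<eta>"] by (auto simp: of_bool_def)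
    next
      case False
      show ?thesis
      proof (cases "\<exists>c\<in>C. x \<le> c \<and> c \<le> x + \<eta>")
        case True
        then obtain c where c: "c \<in> C" "x \<le> c" "c \<le> x + \<eta>" by blast
        have "1 - \<eta> / \<delta> \<le> s (x + \<eta> - c)"
          using c False \<eta> \<delta>(1) by (auto simp: s_def field_simps)
        then have 1: "1 - \<eta> / \<delta> \<le> \<phi> (x + \<eta>)" using ge[OF c(1), of "x + \<eta>"] by linarith
        \<comment> \<open>Any tooth that started at or before \<open>x - \<eta>\<close> started at
          least \<open>\<delta>\<close> before \<open>c\<close>, so within distance
          \<open>2 * \<eta>\<close> of its end only a height of \<open>2 * \<eta> / \<delta>\<close>
          is left.\<close>
        have 2: "\<phi> (x - \<eta>) \<le> 2 * \<eta> / \<delta>"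
        proof (rule le)
          show "0 \<le> 2 * \<eta> / \<delta>" using \<eta> \<delta>(1) by simp
          fix c' assume c': "c' \<in> C"
          show "s (x - \<eta> - c') \<le> 2 * \<eta> / \<delta>"
          proof (cases "c' \<le> x - \<eta>")
            case True
            then have "\<delta> \<le> c - c'" using \<delta>(2)[OF c' c(1)] c \<eta> by linarith
            then show ?thesis using \<eta> c by (intro s_le) auto
          qed (use \<delta>(1) \<eta> in \<open>auto simp: s_def\<close>)
        qed
        have "4 / \<delta> * \<eta> = 4 * (\<eta> / \<delta>)" "2 * \<eta> / \<delta> = 2 * (\<eta> / \<delta>)" "0 \<le> \<eta> / \<delta>" using \<delta>(1) \<eta> by auto
        then show ?thesis using 1 2 True by simp
      next
        case none: False
        have "\<phi> (x - \<eta>) \<le> \<phi> (x + \<eta>) + 4 / \<delta> * \<eta>"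
        proof (rule le)
          show "0 \<le> \<phi> (x + \<eta>) + 4 / \<delta> * \<eta>" using \<eta> \<delta>(1) ge0[of "x + \<eta>"] by (simp add: add_nonneg_nonneg)
          fix c' assume c': "c' \<in> C"
          have "s (x - \<eta> - c') \<le> s (x + \<eta> - c') + 4 / \<delta> * \<eta>"
          proof (cases "x + \<eta> < c' + \<delta>")
            case True
            then show ?thesis using \<delta>(1) \<eta> False by (auto simp: s_def field_simps)
          next
            case ge: False
            then have "s (x - \<eta> - c') \<le> 4 * \<eta> / \<delta>" using \<eta> by (intro s_le) auto
            then show ?thesis using s01(1)[of "x + \<eta> - c'"] by simp
          qed
          then show "s (x - \<eta> - c') \<le> \<phi> (x + \<eta>) + 4 / \<delta> * \<eta>" using ge[OF c', of "x + \<eta>"] by linarith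
        qed
        then show ?thesis unfolding of_bool_def if_not_P[OF none] by simp
      qed
    qed
  qed
qed

text \<open>Multiplying the sawtooth inequality at \<open>l z\<close> by \<open>f z\<close> and
  integrating bounds the mass by the difference of the integrals of f against \<phi>(l z + \<eta>)
  and \<phi>(l z - \<eta>), up to an error. Since \<open>l e = 1\<close>, the two are related by a
  translation by 2 \<eta> e, which can be moved onto f. As \<phi> has values in [0,1], the modulus
  gets the coefficient 1; the set \<open>C\<close> influences only \<open>K\<close>, which is chosen
  before f and \<eta>.\<close>

lemma nn_integral_strip_le:
  fixes l :: "'a::euclidean_space \<Rightarrow> real"
  assumes C: "finite C" and l: "linear l" "l e = 1"
  obtains K where "0 \<le> K"
    "\<And>f \<eta>. f \<in> borel_measurable borel \<Longrightarrow> (\<And>z. 0 \<le> f z) \<Longrightarrow> (\<integral>\<^sup>+z. ennreal (f z) \<partial>lborel) = 1 \<Longrightarrow> 0 < \<eta> \<Longrightarrow>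
      (\<integral>\<^sup>+z. ennreal (f z) * indicator (strip l \<eta> C) z \<partial>lborel)
        \<le> shift_dist ((2 * \<eta>) *\<^sub>R e) f + ennreal (K * \<eta>)"
proof -
  obtain \<phi> K where \<phi>[measurable]: "\<phi> \<in> borel_measurable borel" and \<phi>01: "\<And>x. 0 \<le> \<phi> x" "\<And>x. \<phi> x \<le> 1"
    and K: "0 \<le> (K::real)"
    and saw: "\<And>x \<eta>. 0 < \<eta> \<Longrightarrow> of_bool (\<exists>c\<in>C. x \<le> c \<and> c \<le> x + \<eta>) + \<phi> (x - \<eta>) \<le> \<phi> (x + \<eta>) + K * \<eta>"
    by (rule sawtooth[OF C]) (rule that)
  have lm[measurable]: "l \<in> borel_measurable borel"
    by (intro borel_measurable_continuous_onI linear_continuous_on) (simp add: linear_linear l(1))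
  show thesis
  proof (rule that[OF K])
    fix f :: "'a \<Rightarrow> real" and \<eta> :: real
    assume f[measurable]: "f \<in> borel_measurable borel" and f0: "\<And>z. 0 \<le> f z"
      and f1: "(\<integral>\<^sup>+z. ennreal (f z) \<partial>lborel) = 1" and \<eta>: "0 < \<eta>"
    have sm[measurable]: "strip l \<eta> C \<in> sets borel" using C by measurable
    let ?I = "\<integral>\<^sup>+z. ennreal (f z) * indicator (strip l \<eta> C) z \<partial>lborel"
    let ?v = "(2 * \<eta>) *\<^sub>R e"
    define J where "J = (\<integral>\<^sup>+z. ennreal (f z * \<phi> (l z - \<eta>)) \<partial>lborel)"
    have "?I + J = (\<integral>\<^sup>+z. ennreal (f z) * indicator (strip l \<eta> C) z + ennreal (f z * \<phi> (l z - \<eta>)) \<partial>lborel)"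
      unfolding J_def by (rule nn_integral_add[symmetric]) measurable
    also have "\<dots> \<le> (\<integral>\<^sup>+z. ennreal (f z * \<phi> (l z + \<eta>)) + ennreal (K * \<eta>) * ennreal (f z) \<partial>lborel)"
    proof (rule nn_integral_mono)
      fix z
      have "f z * (of_bool (\<exists>c\<in>C. l z \<le> c \<and> c \<le> l z + \<eta>) + \<phi> (l z - \<eta>)) \<le> f z * (\<phi> (l z + \<eta>) + K * \<eta>)"
        by (rule mult_left_mono[OF saw[OF \<eta>] f0])
      moreover have "indicator (strip l \<eta> C) z = ennreal (of_bool (\<exists>c\<in>C. l z \<le> c \<and> c \<le> l z + \<eta>))"
        by (auto simp: strip_def)
      ultimately show "ennreal (f z) * indicator (strip l \<eta> C) z + ennreal (f z * \<phi> (l z - \<eta>))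
          \<le> ennreal (f z * \<phi> (l z + \<eta>)) + ennreal (K * \<eta>) * ennreal (f z)"
        using f0 \<phi>01 K \<eta> by (simp add: algebra_simps flip: ennreal_plus ennreal_mult)
    qed
    also have "\<dots> = (\<integral>\<^sup>+z. ennreal (f z * \<phi> (l z + \<eta>)) \<partial>lborel) + ennreal (K * \<eta>) * (\<integral>\<^sup>+z. ennreal (f z) \<partial>lborel)"
      by (subst nn_integral_add) (auto simp: nn_integral_cmult)
    \<comment> \<open>The substitution moves the translation from \<open>\<phi>\<close> to
      \<open>f\<close>: after it both integrals carry the same factor
      \<open>\<phi> (l z - \<eta>)\<close>.\<close>
    also have "(\<integral>\<^sup>+z. ennreal (f z * \<phi> (l z + \<eta>)) \<partial>lborel) = (\<integral>\<^sup>+z. ennreal (f (z + - ?v) * \<phi> (l (z + - ?v) + \<eta>)) \<partial>lborel)"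
      by (rule nn_integral_lborel_shift[symmetric]) measurable
    also have "\<dots> \<le> (\<integral>\<^sup>+z. ennreal \<bar>f (z + - ?v) - f ((z + - ?v) + ?v)\<bar> + ennreal (f z * \<phi> (l z - \<eta>)) \<partial>lborel)"
    proof (rule nn_integral_mono)
      fix z
      have e: "l (z + - ?v) + \<eta> = l z - \<eta>"
        using l by (simp add: linear_diff linear_scale)
      have "f (z + - ?v) * \<phi> (l z - \<eta>) = (f (z + - ?v) - f z) * \<phi> (l z - \<eta>) + f z * \<phi> (l z - \<eta>)"
        by (simp add: algebra_simps)
      also have "(f (z + - ?v) - f z) * \<phi> (l z - \<eta>) \<le> \<bar>f (z + - ?v) - f z\<bar> * 1"
        using \<phi>01 by (intro mult_mono) auto
      finally show "ennreal (f (z + - ?v) * \<phi> (l (z + - ?v) + \<eta>)) \<le> ennreal \<bar>f (z + - ?v) - f ((z + - ?v) + ?v)\<bar> + ennreal (f z * \<phi> (l z - \<eta>))"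
        unfolding e using f0 \<phi>01 by (simp add: ennreal_leI flip: ennreal_plus)
    qed
    also have "\<dots> = (\<integral>\<^sup>+z. ennreal \<bar>f (z + - ?v) - f ((z + - ?v) + ?v)\<bar> \<partial>lborel) + J"
      unfolding J_def by (rule nn_integral_add) measurable
    also have "(\<integral>\<^sup>+z. ennreal \<bar>f (z + - ?v) - f ((z + - ?v) + ?v)\<bar> \<partial>lborel) = (\<integral>\<^sup>+z. ennreal \<bar>f z - f (z + ?v)\<bar> \<partial>lborel)"
      by (rule nn_integral_lborel_shift[where g = "\<lambda>z. ennreal \<bar>f z - f (z + ?v)\<bar>"]) measurable
    also have "\<dots> = shift_dist ?v f" unfolding shift_dist_def by (simp add: abs_minus_commute)
    finally have main: "J + ?I \<le> J + (shift_dist ?v f + ennreal (K * \<eta>))"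
      using f1 by (simp add: ac_simps)
    \<comment> \<open>Finiteness of \<open>J\<close> is what permits cancelling it in the extended
      reals.\<close>
    have "J \<le> (\<integral>\<^sup>+z. ennreal (f z) \<partial>lborel)"
      unfolding J_def using f0 \<phi>01 by (intro nn_integral_mono ennreal_leI mult_left_le) auto
    then have "J \<noteq> \<infinity>" using f1 by (auto simp: top_unique)
    then show "?I \<le> shift_dist ?v f + ennreal (K * \<eta>)"
      using main by (simp add: ennreal_add_left_cancel_le)
  qed
qed

text \<open>The mean of f over a square of side h with corner z is at most 1/h^2, because f has
  total mass 1. So the excess of f over 1/h^2 is at most the mean of |f(z + v) - f(z)| over v in the
  square; after Fubini each v contributes at most 2 V h, by one move along each axis. The conversion
  \<open>ennreal\<close> of a negative number is 0, so the integrand is the positive part.\<close>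

lemma nn_integral_truncation_excess:
  fixes f :: "real \<times> real \<Rightarrow> real"
  assumes [measurable]: "f \<in> borel_measurable borel" and f0: "\<And>z. 0 \<le> f z"
    and f1: "(\<integral>\<^sup>+z. ennreal (f z) \<partial>lborel) = 1"
    and V: "0 \<le> V" "\<And>h. 0 < h \<Longrightarrow> shift_dist (h *\<^sub>R (1, 0)) f \<le> ennreal (V * h)"
      "\<And>h. 0 < h \<Longrightarrow> shift_dist (h *\<^sub>R (0, 1)) f \<le> ennreal (V * h)"
    and h: "0 < h"
  shows "(\<integral>\<^sup>+z. ennreal (f z - 1 / h\<^sup>2) \<partial>lborel) \<le> ennreal (2 * V * h)"
proof -
  define Q where "Q = cbox (0::real, 0::real) (h, h)"
  have Qm[measurable]: "Q \<in> sets borel" unfolding Q_def by simp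
  have eQ: "emeasure lborel Q = ennreal (h\<^sup>2)"
    unfolding Q_def using h
    by (subst emeasure_lborel_cbox) (auto simp: Basis_prod_def power2_eq_square prod.union_disjoint)
  have cancel: "ennreal (1 / h\<^sup>2) * (ennreal (h\<^sup>2) * x) = x" for x
    using h by (simp add: mult.assoc[symmetric] flip: ennreal_mult)
  have sd: "shift_dist v f \<le> ennreal (2 * V * h)" if "v \<in> Q" for v
  proof -
    obtain a b where v: "v = (a, b)" by (cases v)
    have ab: "0 \<le> a" "a \<le> h" "0 \<le> b" "b \<le> h" using that by (auto simp: Q_def v)
    have "shift_dist v f \<le> shift_dist (a *\<^sub>R (1, 0)) f + shift_dist (b *\<^sub>R (0, 1)) f"
      using shift_dist_add[of f "a *\<^sub>R (1, 0)" "b *\<^sub>R (0, 1)"] by (simp add: v)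
    also have "shift_dist (a *\<^sub>R (1, 0)) f \<le> ennreal (V * h)"
    proof (cases "a = 0")
      case False
      then show ?thesis using V(2)[of a] ab V(1)
        by (intro order_trans[OF V(2)] ennreal_leI mult_left_mono) auto
    qed (simp add: zero_prod_def[symmetric])
    also have "shift_dist (b *\<^sub>R (0, 1)) f \<le> ennreal (V * h)"
    proof (cases "b = 0")
      case False
      then show ?thesis using V(3)[of b] ab V(1)
        by (intro order_trans[OF V(3)] ennreal_leI mult_left_mono) auto
    qed (simp add: zero_prod_def[symmetric])
    also have "ennreal (V * h) + ennreal (V * h) = ennreal (2 * V * h)"
      using V(1) h by (simp flip: ennreal_plus)
    finally show ?thesis by (simp add: add_mono)
  qed
  define G where "G z = (\<integral>\<^sup>+v. ennreal \<bar>f (z + v) - f z\<bar> * indicator Q v \<partial>lborel)" for z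
  have pt: "ennreal (f z - 1 / h\<^sup>2) \<le> ennreal (1 / h\<^sup>2) * G z" for z
  proof -
    have "ennreal (h\<^sup>2) * ennreal (f z) = (\<integral>\<^sup>+v. ennreal (f z) * indicator Q v \<partial>lborel)"
      by (simp add: nn_integral_cmult_indicator eQ mult.commute)
    also have "\<dots> \<le> (\<integral>\<^sup>+v. ennreal \<bar>f (z + v) - f z\<bar> * indicator Q v + ennreal (f (v + z)) \<partial>lborel)"
      using f0 by (intro nn_integral_mono) (auto simp: indicator_def add.commute simp flip: ennreal_plus intro!: ennreal_leI)
    also have "\<dots> = G z + (\<integral>\<^sup>+v. ennreal (f (v + z)) \<partial>lborel)"
      unfolding G_def by (rule nn_integral_add) measurable
    also have "(\<integral>\<^sup>+v. ennreal (f (v + z)) \<partial>lborel) = 1"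
      using nn_integral_lborel_shift[of "\<lambda>v. ennreal (f v)" z] f1 by simp
    finally have "ennreal (h\<^sup>2) * ennreal (f z) - 1 \<le> G z"
      by (simp add: ennreal_minus_le_iff add.commute)
    then have "ennreal (1 / h\<^sup>2) * (ennreal (h\<^sup>2) * ennreal (f z - 1 / h\<^sup>2)) \<le> ennreal (1 / h\<^sup>2) * G z"
    proof (intro mult_left_mono)
      have "ennreal (h\<^sup>2) * ennreal (f z) - 1 = ennreal (h\<^sup>2 * f z - 1)"
        using f0 by (simp flip: ennreal_mult ennreal_1 add: ennreal_minus)
      also have "h\<^sup>2 * f z - 1 = h\<^sup>2 * (f z - 1 / h\<^sup>2)" using h by (simp add: field_simps)
      finally show "ennreal (h\<^sup>2) * ennreal (f z - 1 / h\<^sup>2) \<le> G z" if "ennreal (h\<^sup>2) * ennreal (f z) - 1 \<le> G z"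
        using that by (simp add: ennreal_mult')
    qed auto
    then show ?thesis unfolding cancel .
  qed
  have "(\<integral>\<^sup>+z. ennreal (f z - 1 / h\<^sup>2) \<partial>lborel) \<le> (\<integral>\<^sup>+z. ennreal (1 / h\<^sup>2) * G z \<partial>lborel)"
    by (intro nn_integral_mono pt)
  also have "\<dots> = ennreal (1 / h\<^sup>2) * (\<integral>\<^sup>+z. G z \<partial>lborel)"
    unfolding G_def by (intro nn_integral_cmult) measurable
  also have "(\<integral>\<^sup>+z. G z \<partial>lborel) = (\<integral>\<^sup>+v. (\<integral>\<^sup>+z. ennreal \<bar>f (z + v) - f z\<bar> * indicator Q v \<partial>lborel) \<partial>lborel)"
    unfolding G_def by (rule lborel_pair.Fubini') measurable
  also have "\<dots> \<le> (\<integral>\<^sup>+v. ennreal (2 * V * h) * indicator Q v \<partial>lborel)"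
  proof (rule nn_integral_mono)
    fix v :: "real \<times> real"
    have "(\<integral>\<^sup>+z. ennreal \<bar>f (z + v) - f z\<bar> * indicator Q v \<partial>lborel) = shift_dist v f * indicator Q v"
      unfolding shift_dist_def by (rule nn_integral_multc) measurable
    then show "(\<integral>\<^sup>+z. ennreal \<bar>f (z + v) - f z\<bar> * indicator Q v \<partial>lborel) \<le> ennreal (2 * V * h) * indicator Q v"
      using sd[of v] by (auto simp: indicator_def)
  qed
  also have "\<dots> = ennreal (h\<^sup>2) * ennreal (2 * V * h)"
    using eQ by (subst nn_integral_cmult_indicator) (simp_all add: mult.commute)
  finally show ?thesis unfolding cancel by (simp add: mult_left_mono)
qed

section \<open>The transfer operator\<close>

lemma sum_1_6: "(\<Sum>k\<in>{1..6::nat}. f k) = f 1 + f 2 + f 3 + f 4 + f 5 + (f 6 :: 'b::comm_monoid_add)"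
  by (simp add: eval_nat_numeral atLeastAtMostSuc_conv ac_simps)

locale random_beta =
  fixes \<beta> p s t :: real
  assumes beta: "1 < \<beta>" "\<beta> < 3/2" and par: "0 < p" "p < 1" "0 < s" "0 < t" "s + t < 1"
begin

definition weight :: "nat \<Rightarrow> real \<times> real \<Rightarrow> real" where
  "weight i z = (\<Sum>k\<in>{1..6}. pk p s t k * of_bool (digit \<beta> k z = qv i))"

definition branch :: "nat \<Rightarrow> real \<times> real \<Rightarrow> real \<times> real" where
  "branch i z = (1/\<beta>) *\<^sub>R (z + qv i)"

definition transfer :: "(real \<times> real \<Rightarrow> real) \<Rightarrow> real \<times> real \<Rightarrow> real" where
  "transfer f z = (\<Sum>i<3. weight i (branch i z) / \<beta>\<^sup>2 * f (branch i z))"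

text \<open>Extended-valued twin of \<open>transfer\<close>. Differences of functions need the real
  version, whereas lower limits of densities may be infinite and are handled by this one.\<close>

definition transfer_ennreal :: "(real \<times> real \<Rightarrow> ennreal) \<Rightarrow> real \<times> real \<Rightarrow> ennreal" where
  "transfer_ennreal f z = (\<Sum>i<3. ennreal (weight i (branch i z) / \<beta>\<^sup>2) * f (branch i z))"

lemma pk_nonneg: "0 \<le> pk p s t k"
  using par by (auto simp: pk_def)

lemma sum_pk: "(\<Sum>k\<in>{1..6}. pk p s t k) = 1"
  unfolding sum_1_6 by (simp add: pk_def algebra_simps)

lemma qv_inj: "i < 3 \<Longrightarrow> j < 3 \<Longrightarrow> qv i = qv j \<longleftrightarrow> i = j"
  by (auto simp: qv_def)

lemma digit_cases: "\<exists>i<3. digit \<beta> k z = qv i"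
proof -
  have "digit \<beta> k z = qv 0 \<or> digit \<beta> k z = qv 1 \<or> digit \<beta> k z = qv 2"
    by (simp add: digit_def)
  moreover have "0 < (3::nat)" "1 < (3::nat)" "2 < (3::nat)" by simp_all
  ultimately show ?thesis by blast
qed

lemma sum_of_bool_digit: "(\<Sum>i<3. of_bool (digit \<beta> k z = qv i) * (g (qv i) :: 'b::semiring_1)) = g (digit \<beta> k z)"
proof -
  obtain j where j: "j < 3" "digit \<beta> k z = qv j" using digit_cases by blast
  have "(\<Sum>i<3. of_bool (digit \<beta> k z = qv i) * g (qv i)) = (\<Sum>i<3. if i = j then g (qv j) else 0)"
    using j qv_inj by (intro sum.cong) auto
  then show ?thesis using j by simp
qed

lemma weight_nonneg: "0 \<le> weight i z"
  unfolding weight_def by (intro sum_nonneg mult_nonneg_nonneg pk_nonneg) auto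

text \<open>Grouping the six maps by the digit that they use at z. This is the link between the
  operator, written with three branches, and the invariance equation, written with six maps.\<close>

lemma sum_weight_mult:
  "(\<Sum>i<3. ennreal (weight i z) * g (qv i)) = (\<Sum>k\<in>{1..6}. ennreal (pk p s t k) * g (digit \<beta> k z))"
proof -
  have "ennreal (weight i z) = (\<Sum>k\<in>{1..6}. ennreal (pk p s t k) * of_bool (digit \<beta> k z = qv i))" for i
  proof -
    have "ennreal (weight i z) = (\<Sum>k\<in>{1..6}. ennreal (pk p s t k * of_bool (digit \<beta> k z = qv i)))"
      unfolding weight_def by (rule sum_ennreal[symmetric]) (simp add: pk_nonneg)
    also have "\<dots> = (\<Sum>k\<in>{1..6}. ennreal (pk p s t k) * of_bool (digit \<beta> k z = qv i))"
      by (rule sum.cong) auto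
    finally show ?thesis .
  qed
  then have "(\<Sum>i<3. ennreal (weight i z) * g (qv i)) =
      (\<Sum>i<3. \<Sum>k\<in>{1..6}. ennreal (pk p s t k) * (of_bool (digit \<beta> k z = qv i) * g (qv i)))"
    by (simp only: sum_distrib_right mult.assoc)
  also have "\<dots> = (\<Sum>k\<in>{1..6}. ennreal (pk p s t k) * (\<Sum>i<3. of_bool (digit \<beta> k z = qv i) * g (qv i)))"
    by (subst sum.swap) (simp only: sum_distrib_left)
  finally show ?thesis unfolding sum_of_bool_digit .
qed

lemma sum_weight: "(\<Sum>i<3. weight i z) = 1"
proof -
  have "(\<Sum>i<3. weight i z) = (\<Sum>k\<in>{1..6}. pk p s t k * (\<Sum>i<3. of_bool (digit \<beta> k z = qv i) * 1))"
    unfolding weight_def by (subst sum.swap) (simp only: sum_distrib_left mult_1_right)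
  also have "\<dots> = 1" unfolding sum_of_bool_digit[where g = "\<lambda>_. 1"] using sum_pk by simp
  finally show ?thesis .
qed

lemma digit_measurable [measurable]: "digit \<beta> k \<in> borel_measurable borel"
proof -
  have [measurable]: "E0 \<beta> \<in> sets borel" "E1 \<beta> \<in> sets borel" "E2 \<beta> \<in> sets borel"
    "C01 \<beta> \<in> sets borel" "C12 \<beta> \<in> sets borel" "C02 \<beta> \<in> sets borel" "C012 \<beta> \<in> sets borel"
    unfolding E0_def E1_def E2_def C01_def C12_def C02_def C012_def case_prod_beta
    by measurable
  show ?thesis unfolding digit_def[abs_def] by measurable
qed

lemma tau_measurable [measurable]: "tau \<beta> k \<in> borel_measurable borel"
  unfolding tau_def[abs_def] by measurable

lemma weight_measurable [measurable]: "weight i \<in> borel_measurable borel"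
  unfolding weight_def[abs_def] by measurable

lemma branch_measurable [measurable]: "branch i \<in> borel_measurable borel"
  unfolding branch_def[abs_def] by measurable

lemma transfer_measurable [measurable]:
  assumes [measurable]: "f \<in> borel_measurable borel"
  shows "transfer f \<in> borel_measurable borel"
  unfolding transfer_def[abs_def] by measurable

lemma transfer_ennreal_measurable [measurable]:
  assumes [measurable]: "f \<in> borel_measurable borel"
  shows "transfer_ennreal f \<in> borel_measurable borel"
  unfolding transfer_ennreal_def[abs_def] by measurable

lemma transfer_ennreal_eq:
  assumes "\<And>z. 0 \<le> f z"
  shows "transfer_ennreal (\<lambda>z. ennreal (f z)) z = ennreal (transfer f z)"
proof -
  have "ennreal (transfer f z) = (\<Sum>i<3. ennreal (weight i (branch i z) / \<beta>\<^sup>2 * f (branch i z)))"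
    unfolding transfer_def using assms weight_nonneg by (intro sum_ennreal[symmetric]) simp
  also have "\<dots> = transfer_ennreal (\<lambda>z. ennreal (f z)) z"
    unfolding transfer_ennreal_def using assms weight_nonneg by (intro sum.cong refl ennreal_mult) simp_all
  finally show ?thesis by simp
qed

lemma branch_inverse: "branch i (\<beta> *\<^sub>R u - qv i) = u"
  using beta by (simp add: branch_def)

lemma beta_branch: "\<beta> *\<^sub>R branch i z - qv i = z"
  using beta by (simp add: branch_def)

section \<open>Integration against the transfer operator\<close>

lemma nn_integral_branch:
  assumes [measurable]: "g \<in> borel_measurable borel"
  shows "(\<integral>\<^sup>+z. g (branch i z) \<partial>lborel) = ennreal (\<beta>\<^sup>2) * (\<integral>\<^sup>+u. g u \<partial>lborel)"
  using nn_integral_lborel_scale_shift[of "\<lambda>z. g (branch i z)" \<beta> "- qv i"] beta by (simp add: branch_inverse power2_eq_square)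

text \<open>Substituting u = \<open>branch i z\<close> in each summand, with Jacobian \<beta>^2,
  moves the operator onto the test function. The choices 1, the indicator of a strip and the
  indicator of a Borel set yield preservation of mass, the strip estimates and the invariance
  equation.\<close>

lemma transfer_ennreal_duality:
  assumes [measurable]: "f \<in> borel_measurable borel" "\<phi> \<in> borel_measurable borel"
  shows "(\<integral>\<^sup>+z. \<phi> z * transfer_ennreal f z \<partial>lborel) = (\<integral>\<^sup>+u. (\<Sum>i<3. ennreal (weight i u) * \<phi> (\<beta> *\<^sub>R u - qv i)) * f u \<partial>lborel)"
proof -
  \<comment> \<open>Writing \<open>z\<close> as \<open>\<beta> *\<^sub>R branch i z - qv i\<close>
    makes every summand a function of \<open>branch i z\<close> alone, ready for the
    substitution.\<close>
  have "(\<integral>\<^sup>+z. \<phi> z * transfer_ennreal f z \<partial>lborel) = (\<integral>\<^sup>+z. (\<Sum>i<3. \<phi> (\<beta> *\<^sub>R branch i z - qv i) * (ennreal (weight i (branch i z) / \<beta>\<^sup>2) * f (branch i z))) \<partial>lborel)"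
    unfolding transfer_ennreal_def beta_branch by (simp add: sum_distrib_left)
  also have "\<dots> = (\<Sum>i<3. \<integral>\<^sup>+z. \<phi> (\<beta> *\<^sub>R branch i z - qv i) * (ennreal (weight i (branch i z) / \<beta>\<^sup>2) * f (branch i z)) \<partial>lborel)"
    by (rule nn_integral_sum) measurable
  also have "\<dots> = (\<Sum>i<3. \<integral>\<^sup>+u. ennreal (weight i u) * \<phi> (\<beta> *\<^sub>R u - qv i) * f u \<partial>lborel)"
  proof (rule sum.cong[OF refl])
    fix i
    have "(\<integral>\<^sup>+z. \<phi> (\<beta> *\<^sub>R branch i z - qv i) * (ennreal (weight i (branch i z) / \<beta>\<^sup>2) * f (branch i z)) \<partial>lborel)
      = ennreal (\<beta>\<^sup>2) * (\<integral>\<^sup>+u. \<phi> (\<beta> *\<^sub>R u - qv i) * (ennreal (weight i u / \<beta>\<^sup>2) * f u) \<partial>lborel)"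
      by (rule nn_integral_branch) measurable
    also have "\<dots> = (\<integral>\<^sup>+u. ennreal (\<beta>\<^sup>2) * (\<phi> (\<beta> *\<^sub>R u - qv i) * (ennreal (weight i u / \<beta>\<^sup>2) * f u)) \<partial>lborel)"
      by (rule nn_integral_cmult[symmetric]) measurable
    also have "\<dots> = (\<integral>\<^sup>+u. ennreal (weight i u) * \<phi> (\<beta> *\<^sub>R u - qv i) * f u \<partial>lborel)"
    proof (rule nn_integral_cong)
      fix u
      have "ennreal (weight i u) = ennreal (\<beta>\<^sup>2) * ennreal (weight i u / \<beta>\<^sup>2)"
        using beta weight_nonneg by (simp flip: ennreal_mult)
      then show "ennreal (\<beta>\<^sup>2) * (\<phi> (\<beta> *\<^sub>R u - qv i) * (ennreal (weight i u / \<beta>\<^sup>2) * f u)) = ennreal (weight i u) * \<phi> (\<beta> *\<^sub>R u - qv i) * f u"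
        by (simp only: ac_simps)
    qed
    finally show "(\<integral>\<^sup>+z. \<phi> (\<beta> *\<^sub>R branch i z - qv i) * (ennreal (weight i (branch i z) / \<beta>\<^sup>2) * f (branch i z)) \<partial>lborel)
      = (\<integral>\<^sup>+u. ennreal (weight i u) * \<phi> (\<beta> *\<^sub>R u - qv i) * f u \<partial>lborel)" .
  qed
  also have "\<dots> = (\<integral>\<^sup>+u. (\<Sum>i<3. ennreal (weight i u) * \<phi> (\<beta> *\<^sub>R u - qv i) * f u) \<partial>lborel)"
    by (rule nn_integral_sum[symmetric]) measurable
  finally show ?thesis by (simp only: sum_distrib_right)
qed

lemma sum_ennreal_weight: "(\<Sum>i<3. ennreal (weight i u)) = 1"
  using sum_weight[of u] by (simp add: sum_ennreal weight_nonneg)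

lemma nn_integral_transfer_ennreal:
  assumes [measurable]: "f \<in> borel_measurable borel"
  shows "(\<integral>\<^sup>+z. transfer_ennreal f z \<partial>lborel) = (\<integral>\<^sup>+z. f z \<partial>lborel)"
  using transfer_ennreal_duality[of f "\<lambda>_. 1"] by (simp add: sum_ennreal_weight)

text \<open>
  Multiplying a point by \<open>\<beta>\<close> turns all inequalities that define the pieces of the partition into
  linear ones with the single parameter \<open>r = 1 / (\<beta> - 1) > 2\<close>.
\<close>

abbreviation "r \<equiv> 1 / (\<beta> - 1)"

lemma r_gt: "2 < r"
  using beta by (simp add: field_simps)

lemma scaled:
  "x < 1/\<beta> \<longleftrightarrow> \<beta> * x < 1" "1/\<beta> \<le> x \<longleftrightarrow> 1 \<le> \<beta> * x" "0 \<le> x \<longleftrightarrow> 0 \<le> \<beta> * x"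
  "x + y \<le> 1/(\<beta>*(\<beta>-1)) \<longleftrightarrow> \<beta> * x + \<beta> * y \<le> r"
  "1/(\<beta>*(\<beta>-1)) < x + y \<longleftrightarrow> r < \<beta> * x + \<beta> * y"
  "x + y \<le> 1/(\<beta>-1) \<longleftrightarrow> \<beta> * x + \<beta> * y \<le> r + 1"
proof -
  have b: "0 < \<beta>" "0 < \<beta> - 1" using beta by auto
  have r1: "r + 1 = \<beta> * r" using b by (simp add: field_simps)
  have r2: "1/(\<beta>*(\<beta>-1)) = r / \<beta>" by simp
  show "x < 1/\<beta> \<longleftrightarrow> \<beta> * x < 1" "1/\<beta> \<le> x \<longleftrightarrow> 1 \<le> \<beta> * x" "0 \<le> x \<longleftrightarrow> 0 \<le> \<beta> * x"
    using b by (auto simp: field_simps zero_le_mult_iff)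
  show "x + y \<le> 1/(\<beta>*(\<beta>-1)) \<longleftrightarrow> \<beta> * x + \<beta> * y \<le> r" "1/(\<beta>*(\<beta>-1)) < x + y \<longleftrightarrow> r < \<beta> * x + \<beta> * y"
    unfolding r2 pos_le_divide_eq[OF b(1)] pos_divide_less_eq[OF b(1)] by (simp_all add: algebra_simps)
  show "x + y \<le> 1/(\<beta>-1) \<longleftrightarrow> \<beta> * x + \<beta> * y \<le> r + 1"
    unfolding r1 using b by (simp only: distrib_left[symmetric] mult_le_cancel_left_pos)
qed

lemma tau_in_Sb:
  assumes "z \<in> Sb \<beta>"
  shows "tau \<beta> k z \<in> Sb \<beta>"
proof -
  obtain x y where z: "z = (x, y)" by (cases z)
  define X Y R where "X = \<beta> * x" and "Y = \<beta> * y" and "R = r"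
  have R: "2 < R" using r_gt by (simp add: R_def)
  note sc = scaled(1-3)[of x] scaled(1-3)[of y] scaled(4-6)[of x y]
  have S: "0 \<le> X" "0 \<le> Y" "X + Y \<le> R + 1"
    using assms sc unfolding z Sb_def X_def Y_def R_def by simp_all
  have m: "z \<in> E0 \<beta> \<longleftrightarrow> X < 1 \<and> Y < 1" "z \<in> E1 \<beta> \<longleftrightarrow> Y < 1 \<and> R < X + Y" "z \<in> E2 \<beta> \<longleftrightarrow> X < 1 \<and> R < X + Y"
    "z \<in> C01 \<beta> \<longleftrightarrow> \<not> X < 1 \<and> Y < 1 \<and> X + Y \<le> R" "z \<in> C12 \<beta> \<longleftrightarrow> \<not> X < 1 \<and> \<not> Y < 1 \<and> R < X + Y"
    "z \<in> C02 \<beta> \<longleftrightarrow> X < 1 \<and> \<not> Y < 1 \<and> X + Y \<le> R" "z \<in> C012 \<beta> \<longleftrightarrow> \<not> X < 1 \<and> \<not> Y < 1 \<and> X + Y \<le> R"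
    unfolding z E0_def E1_def E2_def C01_def C12_def C02_def C012_def mem_Collect_eq prod.case sc
    unfolding X_def[symmetric] Y_def[symmetric] R_def[symmetric] using S by (simp_all add: not_less)
  \<comment> \<open>These are the conditions under which subtracting the digit stays in the
    triangle. The bound \<open>2 < R\<close> enters when one digit is forced: \<open>X < 1\<close>
    and \<open>Y < 1\<close> give \<open>X + Y < R\<close>, while \<open>R < X + Y\<close> together
    with one scaled coordinate below 1 makes the other exceed 1.\<close>
  have "digit \<beta> k z = qv 0 \<and> X + Y \<le> R \<or> digit \<beta> k z = qv 1 \<and> 1 \<le> X \<or> digit \<beta> k z = qv 2 \<and> 1 \<le> Y"
    unfolding digit_def m using R S
    by (cases "X < 1"; cases "Y < 1"; cases "X + Y \<le> R") simp_all
  then show ?thesis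
    using S by (auto simp: Sb_def tau_def z qv_def simp flip: X_def Y_def R_def)
qed

text \<open>Inside the triangle the partition is cut by three lines only, so the weights can jump
  only there. Both points must lie in the triangle, since its edges bound the pieces too and the
  digit takes a default value outside.\<close>

lemma digit_cong:
  assumes "z \<in> Sb \<beta>" "z' \<in> Sb \<beta>" "fst z < 1/\<beta> \<longleftrightarrow> fst z' < 1/\<beta>" "snd z < 1/\<beta> \<longleftrightarrow> snd z' < 1/\<beta>"
    "fst z + snd z \<le> 1/(\<beta>*(\<beta>-1)) \<longleftrightarrow> fst z' + snd z' \<le> 1/(\<beta>*(\<beta>-1))"
  shows "digit \<beta> k z = digit \<beta> k z'"
proof -
  have ge: "1/\<beta> \<le> fst z \<longleftrightarrow> 1/\<beta> \<le> fst z'" "1/\<beta> \<le> snd z \<longleftrightarrow> 1/\<beta> \<le> snd z'"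
    "1/(\<beta>*(\<beta>-1)) < fst z + snd z \<longleftrightarrow> 1/(\<beta>*(\<beta>-1)) < fst z' + snd z'"
    using assms(3-5) by linarith+
  have "(z \<in> E0 \<beta> \<longleftrightarrow> z' \<in> E0 \<beta>) \<and> (z \<in> E1 \<beta> \<longleftrightarrow> z' \<in> E1 \<beta>) \<and> (z \<in> E2 \<beta> \<longleftrightarrow> z' \<in> E2 \<beta>) \<and>
     (z \<in> C01 \<beta> \<longleftrightarrow> z' \<in> C01 \<beta>) \<and> (z \<in> C12 \<beta> \<longleftrightarrow> z' \<in> C12 \<beta>) \<and> (z \<in> C02 \<beta> \<longleftrightarrow> z' \<in> C02 \<beta>) \<and>
     (z \<in> C012 \<beta> \<longleftrightarrow> z' \<in> C012 \<beta>)"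
    using assms unfolding Sb_def E0_def E1_def E2_def C01_def C12_def C02_def C012_def case_prod_beta mem_Collect_eq
    by (simp add: ge)
  then show ?thesis unfolding digit_def by simp
qed

subsection \<open>Uniform bound on the translation modulus\<close>

text \<open>Vanishing off the triangle is required at every point: the weights are under control
  only inside, and the triangle later serves as a support of finite measure.\<close>

definition dens :: "(real \<times> real \<Rightarrow> real) \<Rightarrow> bool" where
  "dens f \<longleftrightarrow> f \<in> borel_measurable borel \<and> (\<forall>z. 0 \<le> f z) \<and> (\<forall>z. z \<notin> Sb \<beta> \<longrightarrow> f z = 0) \<and>
    (\<integral>\<^sup>+z. ennreal (f z) \<partial>lborel) = 1"

lemma densD:
  assumes "dens f"
  shows "f \<in> borel_measurable borel" "\<And>z. 0 \<le> f z" "\<And>z. z \<notin> Sb \<beta> \<Longrightarrow> f z = 0"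
    "(\<integral>\<^sup>+z. ennreal (f z) \<partial>lborel) = 1"
  using assms by (auto simp: dens_def)

lemma transfer_nonneg: "(\<And>z. 0 \<le> f z) \<Longrightarrow> 0 \<le> transfer f z"
  unfolding transfer_def by (intro sum_nonneg mult_nonneg_nonneg divide_nonneg_nonneg weight_nonneg) auto

text \<open>The maps preserve the triangle, so a point of it that the i-th affine map sends outside
  cannot have digit q_i there: its weight is 0.\<close>

lemma transfer_support:
  assumes "\<And>z. z \<notin> Sb \<beta> \<Longrightarrow> f z = 0" "z \<notin> Sb \<beta>"
  shows "transfer f z = 0"
proof -
  have "weight i (branch i z) / \<beta>\<^sup>2 * f (branch i z) = 0" if "i < 3" for i
  proof (cases "branch i z \<in> Sb \<beta>")
    case True
    have "digit \<beta> k (branch i z) \<noteq> qv i" for k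
    proof
      assume "digit \<beta> k (branch i z) = qv i"
      then have "tau \<beta> k (branch i z) = z" by (simp add: tau_def beta_branch)
      then show False using tau_in_Sb[OF True, of k] assms(2) by simp
    qed
    then show ?thesis by (simp add: weight_def)
  qed (simp add: assms(1))
  then show ?thesis unfolding transfer_def by (intro sum.neutral) auto
qed

lemma dens_transfer:
  assumes "dens f"
  shows "dens (transfer f)"
proof -
  note [measurable] = densD(1)[OF assms]
  have "(\<integral>\<^sup>+z. ennreal (transfer f z) \<partial>lborel) = (\<integral>\<^sup>+z. transfer_ennreal (\<lambda>z. ennreal (f z)) z \<partial>lborel)"
    using densD(2)[OF assms] by (simp add: transfer_ennreal_eq)
  also have "\<dots> = 1" using densD(4)[OF assms] by (subst nn_integral_transfer_ennreal) auto
  finally show ?thesis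
    unfolding dens_def using densD[OF assms] transfer_nonneg transfer_support by auto
qed

lemma dens_transfer_pow: "dens f \<Longrightarrow> dens ((transfer ^^ n) f)"
  by (induction n) (auto intro: dens_transfer)

text \<open>By duality the strip is pulled back under u -> \<beta> u - q_i. As l(q_i) is 0 or 1, a
  level c comes from (c + 0)/\<beta> or (c + 1)/\<beta> and the width shrinks to \<eta>/\<beta>. All
  three preimages lie in one common strip and the weights sum to 1, so no factor is lost.\<close>

lemma nn_integral_transfer_strip_le:
  assumes f: "dens f" and C: "finite C"
    and l: "linear l" "l \<in> borel_measurable borel" "\<And>i. l (qv i) \<in> {0, 1}"
  shows "(\<integral>\<^sup>+z. ennreal (transfer f z) * indicator (strip l \<eta> C) z \<partial>lborel)
    \<le> (\<integral>\<^sup>+z. ennreal (f z) * indicator (strip l (\<eta> / \<beta>) ((\<lambda>(c, a). (c + a) / \<beta>) ` (C \<times> {0, 1}))) z \<partial>lborel)"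
    (is "_ \<le> (\<integral>\<^sup>+z. ennreal (f z) * indicator ?S z \<partial>lborel)")
proof -
  note [measurable] = densD(1)[OF f] l(2)
  have [measurable]: "strip l \<eta> C \<in> sets borel" using C by measurable
  have "(\<integral>\<^sup>+z. ennreal (transfer f z) * indicator (strip l \<eta> C) z \<partial>lborel)
      = (\<integral>\<^sup>+z. indicator (strip l \<eta> C) z * transfer_ennreal (\<lambda>z. ennreal (f z)) z \<partial>lborel)"
    using densD(2)[OF f] by (simp add: transfer_ennreal_eq mult.commute)
  also have "\<dots> = (\<integral>\<^sup>+u. (\<Sum>i<3. ennreal (weight i u) * indicator (strip l \<eta> C) (\<beta> *\<^sub>R u - qv i)) * ennreal (f u) \<partial>lborel)"
    by (rule transfer_ennreal_duality) measurable
  also have "\<dots> \<le> (\<integral>\<^sup>+u. ennreal (f u) * indicator ?S u \<partial>lborel)"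
  proof (rule nn_integral_mono)
    fix u
    have "indicator (strip l \<eta> C) (\<beta> *\<^sub>R u - qv i) \<le> (indicator ?S u :: ennreal)" for i
    proof (cases "\<beta> *\<^sub>R u - qv i \<in> strip l \<eta> C")
      case True
      then obtain c where c: "c \<in> C" "\<beta> * l u - l (qv i) \<le> c" "c \<le> \<beta> * l u - l (qv i) + \<eta>"
        using l(1) by (auto simp: strip_def linear_diff linear_scale)
      have "l u \<le> (c + l (qv i)) / \<beta>"
        using c beta by (simp add: pos_le_divide_eq mult.commute)
      moreover have "(c + l (qv i)) / \<beta> \<le> (\<beta> * l u + \<eta>) / \<beta>"
        using c beta by (intro divide_right_mono) auto
      moreover have "(\<beta> * l u + \<eta>) / \<beta> = l u + \<eta> / \<beta>"
        using beta by (simp add: add_divide_distrib)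
      ultimately have "u \<in> ?S"
        unfolding strip_def using c(1) l(3)[of i]
        by (intro CollectI bexI[of _ "(c + l (qv i)) / \<beta>"] conjI) (auto intro!: image_eqI[of _ _ "(c, l (qv i))"])
      then show ?thesis using True by simp
    qed simp
    then have "(\<Sum>i<3. ennreal (weight i u) * indicator (strip l \<eta> C) (\<beta> *\<^sub>R u - qv i)) \<le> (\<Sum>i<3. ennreal (weight i u) * indicator ?S u)"
      by (intro sum_mono mult_left_mono) auto
    also have "\<dots> = indicator ?S u"
      by (simp only: sum_distrib_right[symmetric] sum_ennreal_weight mult_1_left)
    finally show "(\<Sum>i<3. ennreal (weight i u) * indicator (strip l \<eta> C) (\<beta> *\<^sub>R u - qv i)) * ennreal (f u) \<le> ennreal (f u) * indicator ?S u"
      by (subst mult.commute) (rule mult_left_mono, auto)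
  qed
  finally show ?thesis .
qed

text \<open>The number of levels may double at each step, but \<open>C'\<close> is chosen before f
  and \<eta>, so the constant later derived from it depends only on n, \<open>C\<close> and
  \<open>l\<close>.\<close>

lemma nn_integral_transfer_pow_strip_le:
  assumes "finite C" and l: "linear l" "l \<in> borel_measurable borel" "\<And>i. l (qv i) \<in> {0, 1}"
  shows "\<exists>C'. finite C' \<and> (\<forall>f \<eta>. dens f \<longrightarrow>
    (\<integral>\<^sup>+z. ennreal ((transfer ^^ n) f z) * indicator (strip l \<eta> C) z \<partial>lborel)
      \<le> (\<integral>\<^sup>+z. ennreal (f z) * indicator (strip l (\<eta> / \<beta> ^ n) C') z \<partial>lborel))"
  using assms(1)
proof (induction n arbitrary: C)
  case 0
  then show ?case by (intro exI[of _ C]) simp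
next
  case (Suc n)
  let ?D = "(\<lambda>(c, a). (c + a) / \<beta>) ` (C \<times> {0, 1})"
  have "finite ?D" using Suc.prems by simp
  from Suc.IH[OF this] obtain C' where C': "finite C'"
    "\<And>f \<eta>. dens f \<Longrightarrow> (\<integral>\<^sup>+z. ennreal ((transfer ^^ n) f z) * indicator (strip l \<eta> ?D) z \<partial>lborel)
      \<le> (\<integral>\<^sup>+z. ennreal (f z) * indicator (strip l (\<eta> / \<beta> ^ n) C') z \<partial>lborel)" by blast
  show ?case
  proof (intro exI[of _ C'] conjI allI impI C'(1))
    fix f \<eta> assume f: "dens f"
    show "(\<integral>\<^sup>+z. ennreal ((transfer ^^ Suc n) f z) * indicator (strip l \<eta> C) z \<partial>lborel)
      \<le> (\<integral>\<^sup>+z. ennreal (f z) * indicator (strip l (\<eta> / \<beta> ^ Suc n) C') z \<partial>lborel)"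
      using order_trans[OF nn_integral_transfer_strip_le[OF dens_transfer_pow[OF f, of n] Suc.prems l, of \<eta>] C'(2)[OF f, of "\<eta> / \<beta>"]]
      by (simp add: divide_divide_eq_left)
  qed
qed

text \<open>An axis direction with its coordinate. Moving along \<open>e\<close> changes
  \<open>l\<close> and \<open>coord_sum\<close> at unit rate and keeps the other coordinate, so only
  two of the three families of jump lines are ever crossed.\<close>

definition coord :: "real \<times> real \<Rightarrow> (real \<times> real \<Rightarrow> real) \<Rightarrow> bool" where
  "coord e l \<longleftrightarrow> e = (1, 0) \<and> l = fst \<or> e = (0, 1) \<and> l = snd"

abbreviation "coord_sum \<equiv> (\<lambda>z::real \<times> real. fst z + snd z)"

lemma coord_facts:
  assumes "coord e l"
  shows "linear l" "l \<in> borel_measurable borel" "l (qv i) \<in> {0, 1}" "l e = 1"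
  using assms by (auto simp: coord_def linear_fst linear_snd qv_def)

lemma coord_sum_facts: "linear coord_sum" "coord_sum \<in> borel_measurable borel" "coord_sum (qv i) \<in> {0, 1}" "coord e l \<Longrightarrow> coord_sum e = 1"
  by (auto simp: coord_def qv_def linear_fst linear_snd intro!: linear_compose_add)

text \<open>The factor 2 comes from the translate by twice the width; the number and spacing of the
  pulled back lines are absorbed in \<open>K\<close>.\<close>

lemma transfer_pow_strip_bound:
  assumes C: "finite C" and l: "linear l" "l \<in> borel_measurable borel" "\<And>i. l (qv i) \<in> {0, 1}" "l e = 1"
  obtains K where "0 \<le> K"
    "\<And>f V \<eta>. dens f \<Longrightarrow> 0 \<le> V \<Longrightarrow> (\<And>h. 0 < h \<Longrightarrow> shift_dist (h *\<^sub>R e) f \<le> ennreal (V * h)) \<Longrightarrow> 0 < \<eta> \<Longrightarrow>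
      (\<integral>\<^sup>+z. ennreal ((transfer ^^ n) f z) * indicator (strip l \<eta> C) z \<partial>lborel) \<le> ennreal ((2 * V + K) * \<eta> / \<beta> ^ n)"
proof -
  obtain C' where C': "finite C'"
    "\<And>f \<eta>. dens f \<Longrightarrow> (\<integral>\<^sup>+z. ennreal ((transfer ^^ n) f z) * indicator (strip l \<eta> C) z \<partial>lborel)
      \<le> (\<integral>\<^sup>+z. ennreal (f z) * indicator (strip l (\<eta> / \<beta> ^ n) C') z \<partial>lborel)"
    using nn_integral_transfer_pow_strip_le[OF C l(1-3), of n] by blast
  obtain K where K: "0 \<le> K"
    "\<And>f \<eta>. f \<in> borel_measurable borel \<Longrightarrow> (\<And>z. 0 \<le> f z) \<Longrightarrow> (\<integral>\<^sup>+z. ennreal (f z) \<partial>lborel) = 1 \<Longrightarrow> 0 < \<eta> \<Longrightarrow>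
      (\<integral>\<^sup>+z. ennreal (f z) * indicator (strip l \<eta> C') z \<partial>lborel) \<le> shift_dist ((2 * \<eta>) *\<^sub>R e) f + ennreal (K * \<eta>)"
    by (rule nn_integral_strip_le[OF C'(1) l(1) l(4)]) (rule that; blast)
  show thesis
  proof (rule that[OF K(1)])
    fix f V \<eta> assume f: "dens f" and V: "0 \<le> V" "\<And>h. 0 < h \<Longrightarrow> shift_dist (h *\<^sub>R e) f \<le> ennreal (V * h)" and \<eta>: "0 < (\<eta>::real)"
    define \<zeta> where "\<zeta> = \<eta> / \<beta> ^ n"
    have \<zeta>: "0 < \<zeta>" using \<eta> beta by (simp add: \<zeta>_def)
    note C'(2)[OF f, of \<eta>]
    also note K(2)[OF densD(1,2,4)[OF f] \<zeta>, unfolded \<zeta>_def]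
    also have "shift_dist ((2 * (\<eta> / \<beta> ^ n)) *\<^sub>R e) f \<le> ennreal (V * (2 * \<zeta>))"
      using V(2)[of "2 * \<zeta>"] \<zeta> by (simp add: \<zeta>_def)
    also have "ennreal (V * (2 * \<zeta>)) + ennreal (K * (\<eta> / \<beta> ^ n)) = ennreal (V * (2 * \<zeta>) + K * \<zeta>)"
      using V(1) K(1) \<zeta> by (simp flip: \<zeta>_def)
    also have "V * (2 * \<zeta>) + K * \<zeta> = (2 * V + K) * \<eta> / \<beta> ^ n"
      by (simp add: \<zeta>_def algebra_simps add_divide_distrib)
    finally show "(\<integral>\<^sup>+z. ennreal ((transfer ^^ n) f z) * indicator (strip l \<eta> C) z \<partial>lborel) \<le> ennreal ((2 * V + K) * \<eta> / \<beta> ^ n)"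
      by (simp add: add_right_mono)
  qed
qed

section \<open>From one step of the operator to a bound for all iterates\<close>

lemma sum_weight_diff_le: "(\<Sum>i<3. \<bar>weight i u' - weight i u\<bar>) \<le> 2"
proof -
  have "(\<Sum>i<3. \<bar>weight i u' - weight i u\<bar>) \<le> (\<Sum>i<3. weight i u' + weight i u)"
    using weight_nonneg by (intro sum_mono) (smt (verit))
  also have "\<dots> = 2" by (simp add: sum.distrib sum_weight)
  finally show ?thesis .
qed

lemma weight_cong:
  assumes "coord e l" "0 < \<eta>" "u \<in> Sb \<beta>" "u + \<eta> *\<^sub>R e \<in> Sb \<beta>"
    and "u \<notin> strip l \<eta> {1/\<beta>}" "u \<notin> strip coord_sum \<eta> {1/(\<beta>*(\<beta>-1))}"
  shows "weight i (u + \<eta> *\<^sub>R e) = weight i u"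
proof -
  have "digit \<beta> k (u + \<eta> *\<^sub>R e) = digit \<beta> k u" for k
    using assms by (intro digit_cong) (auto simp: coord_def strip_def)
  then show ?thesis by (simp add: weight_def)
qed

text \<open>A product rule: the change of f is weighted by probabilities with sum 1, and the change
  of the weights, at most 2 in total, occurs only in the two strips.\<close>

lemma sum_weighted_diff_le:
  assumes f: "dens f" and e: "coord e l" and \<eta>: "0 < \<eta>"
  shows "(\<Sum>i<3. \<bar>weight i (u + \<eta> *\<^sub>R e) * f (u + \<eta> *\<^sub>R e) - weight i u * f u\<bar>) \<le> \<bar>f (u + \<eta> *\<^sub>R e) - f u\<bar> +
    2 * (f u * indicator (strip l \<eta> {1/\<beta>}) u + f u * indicator (strip coord_sum \<eta> {1/(\<beta>*(\<beta>-1))}) u)" (is "?L \<le> _ + 2 * ?J")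
proof -
  let ?u = "u + \<eta> *\<^sub>R e"
  have f0: "0 \<le> f u" "0 \<le> f ?u" using densD(2)[OF f] by auto
  have J0: "0 \<le> ?J" using f0 by simp
  show ?thesis
  \<comment> \<open>Leaving the triangle belongs to this case. With one of the two values equal to 0
    there is nothing to cancel and the sum is exactly the change of f, so the edges need no strips
    of their own.\<close>
  proof (cases "f u = 0 \<or> f ?u = 0")
    case True
    have "?L = (\<Sum>i<3. weight i ?u * f ?u + weight i u * f u)"
      using True f0 by (intro sum.cong refl) (auto simp: abs_mult abs_of_nonneg[OF weight_nonneg])
    also have "\<dots> = f ?u + f u"
      by (simp add: sum.distrib sum_weight flip: sum_distrib_right)
    also have "\<dots> = \<bar>f ?u - f u\<bar>" using True f0 by auto
    finally show ?thesis using J0 by simp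
  next
    case False
    then have S: "u \<in> Sb \<beta>" "?u \<in> Sb \<beta>" using densD(3)[OF f, of u] densD(3)[OF f, of ?u] by auto
    have "?L \<le> (\<Sum>i<3. weight i ?u * \<bar>f ?u - f u\<bar> + \<bar>weight i ?u - weight i u\<bar> * f u)"
    proof (rule sum_mono)
      fix i
      have "weight i ?u * f ?u - weight i u * f u = weight i ?u * (f ?u - f u) + (weight i ?u - weight i u) * f u"
        by (simp add: algebra_simps)
      then show "\<bar>weight i ?u * f ?u - weight i u * f u\<bar> \<le> weight i ?u * \<bar>f ?u - f u\<bar> + \<bar>weight i ?u - weight i u\<bar> * f u"
        using weight_nonneg[of i ?u] f0 abs_triangle_ineq[of "weight i ?u * (f ?u - f u)" "(weight i ?u - weight i u) * f u"]
        by (simp add: abs_mult)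
    qed
    also have "\<dots> = \<bar>f ?u - f u\<bar> + (\<Sum>i<3. \<bar>weight i ?u - weight i u\<bar>) * f u"
      by (simp add: sum.distrib sum_weight flip: sum_distrib_right)
    also have "(\<Sum>i<3. \<bar>weight i ?u - weight i u\<bar>) * f u \<le> 2 * ?J"
    proof (cases "u \<in> strip l \<eta> {1/\<beta>} \<or> u \<in> strip coord_sum \<eta> {1/(\<beta>*(\<beta>-1))}")
      case True
      then have "f u \<le> ?J" using f0 by (auto simp: indicator_def)
      then show ?thesis
        by (intro order_trans[OF mult_right_mono[OF sum_weight_diff_le f0(1)]] mult_left_mono) auto
    next
      case False
      then show ?thesis using weight_cong[OF e \<eta> S] J0 by simp
    qed
    finally show ?thesis by simp
  qed
qed

text \<open>All inverse branches are homotheties of ratio 1/\<beta>, so each turns a translation by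
  h e into the same translation by (h/\<beta>) e, and the Jacobian cancels the factor 1/\<beta>^2.
  The three branches can therefore be added before they are estimated.\<close>

lemma shift_dist_transfer_le:
  assumes f: "dens f" and e: "coord e l" and h: "0 < h"
  shows "shift_dist (h *\<^sub>R e) (transfer f) \<le> shift_dist ((h / \<beta>) *\<^sub>R e) f +
    2 * ((\<integral>\<^sup>+z. ennreal (f z) * indicator (strip l (h / \<beta>) {1/\<beta>}) z \<partial>lborel) +
         (\<integral>\<^sup>+z. ennreal (f z) * indicator (strip coord_sum (h / \<beta>) {1/(\<beta>*(\<beta>-1))}) z \<partial>lborel))"
proof -
  note [measurable] = densD(1)[OF f] coord_facts(2)[OF e] coord_sum_facts(2)
  define \<eta> where "\<eta> = h / \<beta>"
  have \<eta>: "0 < \<eta>" using h beta by (simp add: \<eta>_def)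
  have [measurable]: "strip l \<eta> {1/\<beta>} \<in> sets borel" "strip coord_sum \<eta> {1/(\<beta>*(\<beta>-1))} \<in> sets borel" by measurable
  let ?D = "\<lambda>i u. \<bar>weight i (u + \<eta> *\<^sub>R e) * f (u + \<eta> *\<^sub>R e) - weight i u * f u\<bar>"
  have branch_shift: "branch i (z + h *\<^sub>R e) = branch i z + \<eta> *\<^sub>R e" for i z
    by (simp add: branch_def \<eta>_def algebra_simps)
  have "shift_dist (h *\<^sub>R e) (transfer f) \<le> (\<integral>\<^sup>+z. (\<Sum>i<3. ennreal (?D i (branch i z) / \<beta>\<^sup>2)) \<partial>lborel)"
    unfolding shift_dist_def
  proof (rule nn_integral_mono)
    fix z
    have "\<bar>transfer f (z + h *\<^sub>R e) - transfer f z\<bar> \<le> (\<Sum>i<3. ?D i (branch i z) / \<beta>\<^sup>2)"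
      unfolding transfer_def branch_shift sum_subtractf[symmetric]
      by (intro order_trans[OF sum_abs] sum_mono) (simp flip: diff_divide_distrib add: abs_divide)
    then show "ennreal \<bar>transfer f (z + h *\<^sub>R e) - transfer f z\<bar> \<le> (\<Sum>i<3. ennreal (?D i (branch i z) / \<beta>\<^sup>2))"
      by (subst sum_ennreal) (auto intro: ennreal_leI)
  qed
  also have "\<dots> = (\<Sum>i<3. \<integral>\<^sup>+z. ennreal (?D i (branch i z) / \<beta>\<^sup>2) \<partial>lborel)"
    by (rule nn_integral_sum) measurable
  also have "\<dots> = (\<Sum>i<3. \<integral>\<^sup>+u. ennreal (?D i u) \<partial>lborel)"
  proof (rule sum.cong[OF refl])
    fix i
    have "(\<integral>\<^sup>+z. ennreal (?D i (branch i z) / \<beta>\<^sup>2) \<partial>lborel) = ennreal (\<beta>\<^sup>2) * (\<integral>\<^sup>+u. ennreal (?D i u / \<beta>\<^sup>2) \<partial>lborel)"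
      by (rule nn_integral_branch) measurable
    also have "\<dots> = (\<integral>\<^sup>+u. ennreal (\<beta>\<^sup>2) * ennreal (?D i u / \<beta>\<^sup>2) \<partial>lborel)"
      by (rule nn_integral_cmult[symmetric]) measurable
    finally show "(\<integral>\<^sup>+z. ennreal (?D i (branch i z) / \<beta>\<^sup>2) \<partial>lborel) = (\<integral>\<^sup>+u. ennreal (?D i u) \<partial>lborel)"
      using beta by (simp flip: ennreal_mult)
  qed
  also have "\<dots> = (\<integral>\<^sup>+u. (\<Sum>i<3. ennreal (?D i u)) \<partial>lborel)"
    by (rule nn_integral_sum[symmetric]) measurable
  also have "\<dots> \<le> (\<integral>\<^sup>+u. ennreal \<bar>f (u + \<eta> *\<^sub>R e) - f u\<bar> +
      2 * (ennreal (f u) * indicator (strip l \<eta> {1/\<beta>}) u + ennreal (f u) * indicator (strip coord_sum \<eta> {1/(\<beta>*(\<beta>-1))}) u) \<partial>lborel)"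
  proof (rule nn_integral_mono)
    fix u
    have f0: "0 \<le> f u" using densD(2)[OF f] .
    have plus_2: "ennreal (a + 2 * b) = ennreal a + 2 * ennreal b" if "0 \<le> a" "0 \<le> b" for a b
      using that by (simp add: ennreal_mult)
    let ?J = "f u * indicator (strip l \<eta> {1/\<beta>}) u + f u * indicator (strip coord_sum \<eta> {1/(\<beta>*(\<beta>-1))}) u"
    have J: "0 \<le> ?J" using f0 by simp
    have "(\<Sum>i<3. ennreal (?D i u)) \<le> ennreal (\<bar>f (u + \<eta> *\<^sub>R e) - f u\<bar> + 2 * ?J)"
      using sum_weighted_diff_le[OF f e \<eta>, of u] by (subst sum_ennreal) (auto intro: ennreal_leI)
    also have "\<dots> = ennreal \<bar>f (u + \<eta> *\<^sub>R e) - f u\<bar> + 2 * ennreal ?J"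
      by (rule plus_2) (use J in auto)
    also have "ennreal ?J = ennreal (f u) * indicator (strip l \<eta> {1/\<beta>}) u + ennreal (f u) * indicator (strip coord_sum \<eta> {1/(\<beta>*(\<beta>-1))}) u"
      using f0 by (auto simp: indicator_def)
    finally show "(\<Sum>i<3. ennreal (?D i u)) \<le> ennreal \<bar>f (u + \<eta> *\<^sub>R e) - f u\<bar> +
      2 * (ennreal (f u) * indicator (strip l \<eta> {1/\<beta>}) u + ennreal (f u) * indicator (strip coord_sum \<eta> {1/(\<beta>*(\<beta>-1))}) u)" .
  qed
  also have "\<dots> = shift_dist (\<eta> *\<^sub>R e) f +
    2 * ((\<integral>\<^sup>+z. ennreal (f z) * indicator (strip l \<eta> {1/\<beta>}) z \<partial>lborel) +
         (\<integral>\<^sup>+z. ennreal (f z) * indicator (strip coord_sum \<eta> {1/(\<beta>*(\<beta>-1))}) z \<partial>lborel))"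
    unfolding shift_dist_def by (simp add: nn_integral_add nn_integral_cmult)
  finally show ?thesis unfolding \<eta>_def .
qed

text \<open>Feeding the one-step bound into itself would multiply V by 9/\<beta> at each step.
  Instead the strips of the last step are pulled back n times to the initial f, where each of the
  two has mass at most (2V + const) times its width; doubled, they add 8V.\<close>

lemma shift_dist_transfer_pow_le:
  assumes e: "coord e l"
  obtains K where "0 \<le> K"
    "\<And>f V h. dens f \<Longrightarrow> 0 \<le> V \<Longrightarrow> (\<And>h. 0 < h \<Longrightarrow> shift_dist (h *\<^sub>R e) f \<le> ennreal (V * h)) \<Longrightarrow> 0 < h \<Longrightarrow>
      shift_dist (h *\<^sub>R e) ((transfer ^^ n) f) \<le> ennreal (((1 + 8 * real n) * V + K) * h / \<beta> ^ n)"
proof (induction n arbitrary: thesis)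
  case 0
  show ?case by (rule "0"[of 0]) auto
next
  case (Suc n)
  obtain K where K: "0 \<le> K"
    "\<And>f V h. dens f \<Longrightarrow> 0 \<le> V \<Longrightarrow> (\<And>h. 0 < h \<Longrightarrow> shift_dist (h *\<^sub>R e) f \<le> ennreal (V * h)) \<Longrightarrow> 0 < h \<Longrightarrow>
      shift_dist (h *\<^sub>R e) ((transfer ^^ n) f) \<le> ennreal (((1 + 8 * real n) * V + K) * h / \<beta> ^ n)"
    by (rule Suc.IH) (rule that; blast)
  obtain K1 where K1: "0 \<le> K1"
    "\<And>f V \<eta>. dens f \<Longrightarrow> 0 \<le> V \<Longrightarrow> (\<And>h. 0 < h \<Longrightarrow> shift_dist (h *\<^sub>R e) f \<le> ennreal (V * h)) \<Longrightarrow> 0 < \<eta> \<Longrightarrow>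
      (\<integral>\<^sup>+z. ennreal ((transfer ^^ n) f z) * indicator (strip l \<eta> {1/\<beta>}) z \<partial>lborel) \<le> ennreal ((2 * V + K1) * \<eta> / \<beta> ^ n)"
    by (rule transfer_pow_strip_bound[where n = n, OF finite.insertI[OF finite.emptyI] coord_facts[OF e], of "1/\<beta>"]) (rule that; blast)
  obtain K2 where K2: "0 \<le> K2"
    "\<And>f V \<eta>. dens f \<Longrightarrow> 0 \<le> V \<Longrightarrow> (\<And>h. 0 < h \<Longrightarrow> shift_dist (h *\<^sub>R e) f \<le> ennreal (V * h)) \<Longrightarrow> 0 < \<eta> \<Longrightarrow>
      (\<integral>\<^sup>+z. ennreal ((transfer ^^ n) f z) * indicator (strip coord_sum \<eta> {1/(\<beta>*(\<beta>-1))}) z \<partial>lborel) \<le> ennreal ((2 * V + K2) * \<eta> / \<beta> ^ n)"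
    by (rule transfer_pow_strip_bound[where n = n, OF finite.insertI[OF finite.emptyI] coord_sum_facts(1-3) coord_sum_facts(4)[OF e], of "1/(\<beta>*(\<beta>-1))"]) (rule that; blast)
  show ?case
  proof (rule Suc.prems)
    show "0 \<le> K + 2 * K1 + 2 * K2" using K(1) K1(1) K2(1) by simp
    fix f V h assume f: "dens f" and V: "0 \<le> V" "\<And>h. 0 < h \<Longrightarrow> shift_dist (h *\<^sub>R e) f \<le> ennreal (V * h)" and h: "0 < (h::real)"
    define \<eta> where "\<eta> = h / \<beta>"
    have \<eta>: "0 < \<eta>" using h beta by (simp add: \<eta>_def)
    have plus_2: "ennreal a + 2 * (ennreal b + ennreal c) = ennreal (a + 2 * (b + c))"
      if "0 \<le> a" "0 \<le> b" "0 \<le> c" for a b c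
    proof -
      have "2 * ennreal (b + c) = ennreal (2 * (b + c))"
        using that by (subst ennreal_mult) auto
      then show ?thesis using that by (simp del: distrib_left_numeral)
    qed
    have "shift_dist (h *\<^sub>R e) ((transfer ^^ Suc n) f) \<le> shift_dist (\<eta> *\<^sub>R e) ((transfer ^^ n) f) +
      2 * ((\<integral>\<^sup>+z. ennreal ((transfer ^^ n) f z) * indicator (strip l \<eta> {1/\<beta>}) z \<partial>lborel) +
         (\<integral>\<^sup>+z. ennreal ((transfer ^^ n) f z) * indicator (strip coord_sum \<eta> {1/(\<beta>*(\<beta>-1))}) z \<partial>lborel))"
      using shift_dist_transfer_le[OF dens_transfer_pow[OF f] e h, of n] by (simp add: \<eta>_def)
    also have "\<dots> \<le> ennreal (((1 + 8 * real n) * V + K) * \<eta> / \<beta> ^ n) +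
      2 * (ennreal ((2 * V + K1) * \<eta> / \<beta> ^ n) + ennreal ((2 * V + K2) * \<eta> / \<beta> ^ n))"
      by (intro add_mono mult_left_mono K(2)[OF f V \<eta>] K1(2)[OF f V \<eta>] K2(2)[OF f V \<eta>]) auto
    also have "\<dots> = ennreal (((1 + 8 * real n) * V + K) * \<eta> / \<beta> ^ n + 2 * ((2 * V + K1) * \<eta> / \<beta> ^ n + (2 * V + K2) * \<eta> / \<beta> ^ n))"
      by (rule plus_2) (use V(1) K(1) K1(1) K2(1) \<eta> beta in auto)
    also have "((1 + 8 * real n) * V + K) * \<eta> / \<beta> ^ n + 2 * ((2 * V + K1) * \<eta> / \<beta> ^ n + (2 * V + K2) * \<eta> / \<beta> ^ n)
      = ((1 + 8 * real (Suc n)) * V + (K + 2 * K1 + 2 * K2)) * h / \<beta> ^ Suc n"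
      using beta by (simp add: \<eta>_def field_simps)
    finally show "shift_dist (h *\<^sub>R e) ((transfer ^^ Suc n) f) \<le> ennreal (((1 + 8 * real (Suc n)) * V + (K + 2 * K1 + 2 * K2)) * h / \<beta> ^ Suc n)" .
  qed
qed

text \<open>Once N is so large that (1 + 8N)/\<beta>^N < 1/2, passing from an iterate to the one N
  steps later sends a constant V to at most V/2 + K N, and this does not exceed V as soon as V is at
  least 2 K N.\<close>

lemma shift_dist_transfer_pow_uniform:
  assumes f: "dens f" and e: "coord e l"
    and V0: "0 \<le> V0" "\<And>h. 0 < h \<Longrightarrow> shift_dist (h *\<^sub>R e) f \<le> ennreal (V0 * h)"
  obtains V where "0 \<le> V" "\<And>n h. 0 < h \<Longrightarrow> shift_dist (h *\<^sub>R e) ((transfer ^^ n) f) \<le> ennreal (V * h)"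
proof -
  have "\<exists>K\<ge>0. \<forall>f V h. dens f \<longrightarrow> 0 \<le> V \<longrightarrow> (\<forall>h>0. shift_dist (h *\<^sub>R e) f \<le> ennreal (V * h)) \<longrightarrow> 0 < h \<longrightarrow>
      shift_dist (h *\<^sub>R e) ((transfer ^^ n) f) \<le> ennreal (((1 + 8 * real n) * V + K) * h / \<beta> ^ n)" for n
    by (rule shift_dist_transfer_pow_le[OF e, of n]) blast
  then obtain K where K0: "\<And>n. 0 \<le> K n" and
    K: "\<And>n f V h. dens f \<Longrightarrow> 0 \<le> V \<Longrightarrow> (\<And>h. 0 < h \<Longrightarrow> shift_dist (h *\<^sub>R e) f \<le> ennreal (V * h)) \<Longrightarrow> 0 < h \<Longrightarrow>
      shift_dist (h *\<^sub>R e) ((transfer ^^ n) f) \<le> ennreal (((1 + 8 * real n) * V + K n) * h / \<beta> ^ n)"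
    by metis
  have "(\<lambda>n. 1 / \<beta> ^ n + 8 * (real n / \<beta> ^ n)) \<longlonglongrightarrow> 0 + 8 * 0"
    using beta by (intro tendsto_intros lim_n_over_pown LIMSEQ_divide_realpow_zero) auto
  then have "eventually (\<lambda>n. 1 / \<beta> ^ n + 8 * (real n / \<beta> ^ n) < 1/2) sequentially"
    by (rule order_tendstoD(2)) simp
  then obtain N where N: "1 / \<beta> ^ N + 8 * (real N / \<beta> ^ N) < 1/2"
    by (auto simp: eventually_sequentially)
  have N0: "N \<noteq> 0" using N by (intro notI) simp
  have pow1: "1 \<le> \<beta> ^ n" for n using beta by (simp add: one_le_power)
  \<comment> \<open>The sum covers the first \<open>N\<close> iterates, estimated directly from
    \<open>V0\<close>; the last term makes \<open>V\<close> stable under \<open>N\<close> further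
    steps.\<close>
  define V where "V = (\<Sum>r<N. (1 + 8 * real r) * V0 + K r) + 2 * K N"
  have term0: "0 \<le> (1 + 8 * real r) * V0 + K r" for r using V0(1) K0[of r] by simp
  have sum0: "0 \<le> (\<Sum>r<N. (1 + 8 * real r) * V0 + K r)"
    by (rule sum_nonneg) (rule term0)
  have sum_ge: "(1 + 8 * real r) * V0 + K r \<le> (\<Sum>r<N. (1 + 8 * real r) * V0 + K r)" if "r < N" for r
    using that term0 by (intro member_le_sum[where f = "\<lambda>r. (1 + 8 * real r) * V0 + K r"]) auto
  have V: "0 \<le> V" "2 * K N \<le> V" "r < N \<Longrightarrow> (1 + 8 * real r) * V0 + K r \<le> V" for r
    unfolding V_def using sum0 sum_ge[of r] K0[of N] by linarith+
  have "\<forall>h>0. shift_dist (h *\<^sub>R e) ((transfer ^^ n) f) \<le> ennreal (V * h)" for n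
  proof (induction n rule: less_induct)
    case (less n)
    show ?case
    proof (cases "n < N")
      case True
      show ?thesis
      proof (intro allI impI)
        fix h :: real assume h: "0 < h"
        note K[OF f V0 h, of n]
        also have "((1 + 8 * real n) * V0 + K n) * h / \<beta> ^ n \<le> V * h"
        proof -
          have "((1 + 8 * real n) * V0 + K n) * h / \<beta> ^ n \<le> ((1 + 8 * real n) * V0 + K n) * h / 1"
            using pow1[of n] term0[of n] h by (intro divide_left_mono) auto
          also have "\<dots> \<le> V * h" using V(3)[OF True] h by simp
          finally show ?thesis .
        qed
        then have "ennreal (((1 + 8 * real n) * V0 + K n) * h / \<beta> ^ n) \<le> ennreal (V * h)" by (rule ennreal_leI)
        finally show "shift_dist (h *\<^sub>R e) ((transfer ^^ n) f) \<le> ennreal (V * h)" .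
      qed
    next
      case False
      have IH: "\<And>h. 0 < h \<Longrightarrow> shift_dist (h *\<^sub>R e) ((transfer ^^ (n - N)) f) \<le> ennreal (V * h)"
        using less.IH[of "n - N"] False N0 by auto
      have eq: "(transfer ^^ N) ((transfer ^^ (n - N)) f) = (transfer ^^ n) f"
        using False funpow_add[of N "n - N" transfer] by (simp add: fun_eq_iff)
      show ?thesis
      proof (intro allI impI)
        fix h :: real assume h: "0 < h"
        note K[OF dens_transfer_pow[OF f] V(1) IH h, of N, unfolded eq]
        also have "((1 + 8 * real N) * V + K N) * h / \<beta> ^ N \<le> V * h"
        proof -
          have "((1 + 8 * real N) * V + K N) * h / \<beta> ^ N
              = (1 / \<beta> ^ N + 8 * (real N / \<beta> ^ N)) * (V * h) + K N * h / \<beta> ^ N"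
            using beta by (simp add: field_simps)
          also have "\<dots> \<le> 1/2 * (V * h) + K N * h / 1"
            using N V(1) h K0[of N] pow1[of N] by (intro add_mono mult_right_mono divide_left_mono) auto
          also have "\<dots> \<le> V * h" using mult_right_mono[OF V(2), of h] h by linarith
          finally show ?thesis .
        qed
        then have "ennreal (((1 + 8 * real N) * V + K N) * h / \<beta> ^ N) \<le> ennreal (V * h)" by (rule ennreal_leI)
        finally show "shift_dist (h *\<^sub>R e) ((transfer ^^ n) f) \<le> ennreal (V * h)" .
      qed
    qed
  qed
  then show thesis using that V(1) by blast
qed

subsection \<open>Averages of the iterates\<close>

text \<open>A convenient initial density with an explicit modulus. It lies in the triangle because
  its corner (1,1) has coordinate sum 2 < r.\<close>

definition unit_square :: "(real \<times> real) set" where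
  "unit_square = cbox (0, 0) (1, 1)"

lemma dens_unit_square: "dens (indicator unit_square)"
proof -
  have "unit_square \<in> sets borel" by (simp add: unit_square_def)
  moreover have "z \<in> Sb \<beta>" if "z \<in> unit_square" for z
    using that r_gt by (auto simp: unit_square_def Sb_def)
  moreover have "(\<integral>\<^sup>+z. ennreal (indicator unit_square z) \<partial>lborel) = 1"
    using emeasure_lborel_cbox_pair[of 0 1 0 1] by (simp add: unit_square_def ennreal_indicator)
  ultimately show ?thesis by (auto simp: dens_def indicator_def)
qed

text \<open>The indicators of the square and of its translate differ only within a slab of width h
  at each of two opposite edges.\<close>

lemma shift_dist_unit_square:
  assumes e: "coord e l" and h: "0 < h"
  shows "shift_dist (h *\<^sub>R e) (indicator unit_square) \<le> ennreal (2 * h)"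
proof -
  obtain A B where AB: "A \<in> sets borel" "B \<in> sets borel" "emeasure lborel A = ennreal h" "emeasure lborel B = ennreal h"
    and le: "\<And>z. \<bar>indicator unit_square (z + h *\<^sub>R e) - indicator unit_square z\<bar> \<le> (indicator A z + indicator B z :: real)"
  proof (cases "e = (1, 0)")
    case True
    show thesis
    proof (rule that[of "cbox (-h, 0) (0, 1)" "cbox (1 - h, 0) (1, 1)"])
      show "\<bar>indicator unit_square (z + h *\<^sub>R e) - indicator unit_square z\<bar>
          \<le> (indicator (cbox (-h, 0) (0, 1)) z + indicator (cbox (1 - h, 0) (1, 1)) z :: real)" for z
        using h True by (cases z) (auto simp: unit_square_def indicator_def)
    qed (use h in \<open>auto simp: emeasure_lborel_cbox_pair\<close>)
  next
    case False
    then have "e = (0, 1)" using e by (auto simp: coord_def)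
    show thesis
    proof (rule that[of "cbox (0, -h) (1, 0)" "cbox (0, 1 - h) (1, 1)"])
      show "\<bar>indicator unit_square (z + h *\<^sub>R e) - indicator unit_square z\<bar>
          \<le> (indicator (cbox (0, -h) (1, 0)) z + indicator (cbox (0, 1 - h) (1, 1)) z :: real)" for z
        using h \<open>e = (0, 1)\<close> by (cases z) (auto simp: unit_square_def indicator_def)
    qed (use h in \<open>auto simp: emeasure_lborel_cbox_pair\<close>)
  qed
  note [measurable] = AB(1,2)
  have "shift_dist (h *\<^sub>R e) (indicator unit_square) \<le> (\<integral>\<^sup>+z. indicator A z + indicator B z \<partial>lborel)"
    unfolding shift_dist_def
  proof (rule nn_integral_mono)
    fix z
    have "ennreal \<bar>indicator unit_square (z + h *\<^sub>R e) - indicator unit_square z\<bar> \<le> ennreal (indicator A z + indicator B z)"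
      by (rule ennreal_leI[OF le])
    also have "\<dots> = indicator A z + indicator B z" by (simp add: ennreal_indicator)
    finally show "ennreal \<bar>indicator unit_square (z + h *\<^sub>R e) - indicator unit_square z\<bar> \<le> indicator A z + indicator B z" .
  qed
  also have "\<dots> = ennreal h + ennreal h"
    using AB by (simp add: nn_integral_add)
  also have "\<dots> = ennreal (2 * h)" using h by (simp flip: ennreal_plus)
  finally show ?thesis .
qed

lemma transfer_sum: "transfer (\<lambda>z. \<Sum>m\<in>I. c * g m z) z = (\<Sum>m\<in>I. c * transfer (g m) z)"
proof -
  have "transfer (\<lambda>z. \<Sum>m\<in>I. c * g m z) z = (\<Sum>i<3. \<Sum>m\<in>I. c * (weight i (branch i z) / \<beta>\<^sup>2 * g m (branch i z)))"
    unfolding transfer_def sum_distrib_left by (intro sum.cong refl) simp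
  also have "\<dots> = (\<Sum>m\<in>I. c * transfer (g m) z)"
    unfolding transfer_def sum_distrib_left by (rule sum.swap)
  finally show ?thesis .
qed

lemma transfer_midpoint: "transfer (\<lambda>z. (g z + g' z) / 2) z = (transfer g z + transfer g' z) / 2"
  unfolding transfer_def sum.distrib[symmetric] sum_divide_distrib by (intro sum.cong refl) (simp add: algebra_simps add_divide_distrib)

text \<open>For n = 0 the empty sum gives the zero function, hence the condition 0 < n in the facts
  about densities.\<close>

definition average :: "nat \<Rightarrow> real \<times> real \<Rightarrow> real" where
  "average n z = (\<Sum>m<n. 1 / real n * (transfer ^^ m) (indicator unit_square) z)"

lemma dens_transfer_pow_square: "dens ((transfer ^^ m) (indicator unit_square))"
  by (rule dens_transfer_pow[OF dens_unit_square])

lemma sum_inverse_ennreal: "0 < n \<Longrightarrow> (\<Sum>m<n. ennreal (1 / real n) * x) = x"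
proof -
  assume n: "0 < n"
  have "(\<Sum>m<n. ennreal (1 / real n) * x) = (of_nat n * ennreal (1 / real n)) * x"
    by (simp add: mult.assoc)
  also have "of_nat n * ennreal (1 / real n) = 1"
    using n by (simp add: ennreal_of_nat_eq_real_of_nat flip: ennreal_mult)
  finally show ?thesis by simp
qed

lemma dens_average:
  assumes n: "0 < n"
  shows "dens (average n)"
proof -
  let ?f = "\<lambda>m. (transfer ^^ m) (indicator unit_square)"
  note d = densD[OF dens_transfer_pow_square]
  note [measurable] = d(1)
  have "(\<integral>\<^sup>+z. ennreal (average n z) \<partial>lborel) = (\<integral>\<^sup>+z. (\<Sum>m<n. ennreal (1 / real n) * ennreal (?f m z)) \<partial>lborel)"
  proof (rule nn_integral_cong)
    fix z
    have "ennreal (average n z) = (\<Sum>m<n. ennreal (1 / real n * ?f m z))"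
      unfolding average_def using d(2) by (intro sum_ennreal[symmetric]) simp
    also have "\<dots> = (\<Sum>m<n. ennreal (1 / real n) * ennreal (?f m z))"
      using d(2) by (intro sum.cong refl ennreal_mult) auto
    finally show "ennreal (average n z) = (\<Sum>m<n. ennreal (1 / real n) * ennreal (?f m z))" .
  qed
  also have "\<dots> = (\<Sum>m<n. ennreal (1 / real n) * (\<integral>\<^sup>+z. ennreal (?f m z) \<partial>lborel))"
    by (simp add: nn_integral_sum nn_integral_cmult)
  also have "\<dots> = 1" unfolding d(4) by (rule sum_inverse_ennreal[OF n])
  finally have "(\<integral>\<^sup>+z. ennreal (average n z) \<partial>lborel) = 1" .
  moreover have "average n \<in> borel_measurable borel" unfolding average_def[abs_def] by measurable
  moreover have "0 \<le> average n z" for z unfolding average_def using d(2) by (intro sum_nonneg) simp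
  moreover have "average n z = 0" if "z \<notin> Sb \<beta>" for z unfolding average_def using d(3) that by simp
  ultimately show ?thesis by (auto simp: dens_def)
qed

lemma shift_dist_average_le:
  assumes n: "0 < n" and le: "\<And>m. shift_dist v ((transfer ^^ m) (indicator unit_square)) \<le> c"
  shows "shift_dist v (average n) \<le> c"
proof -
  let ?f = "\<lambda>m. (transfer ^^ m) (indicator unit_square)"
  note [measurable] = densD(1)[OF dens_transfer_pow_square]
  have "shift_dist v (average n) \<le> (\<integral>\<^sup>+z. (\<Sum>m<n. ennreal (1 / real n) * ennreal \<bar>?f m (z + v) - ?f m z\<bar>) \<partial>lborel)"
    unfolding shift_dist_def
  proof (rule nn_integral_mono)
    fix z
    have "\<bar>average n (z + v) - average n z\<bar> \<le> (\<Sum>m<n. 1 / real n * \<bar>?f m (z + v) - ?f m z\<bar>)"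
      unfolding average_def sum_subtractf[symmetric]
      by (intro order_trans[OF sum_abs] sum_mono) (simp flip: diff_divide_distrib add: abs_divide)
    then have "ennreal \<bar>average n (z + v) - average n z\<bar> \<le> (\<Sum>m<n. ennreal (1 / real n * \<bar>?f m (z + v) - ?f m z\<bar>))"
      by (subst sum_ennreal) (auto intro: ennreal_leI)
    also have "\<dots> = (\<Sum>m<n. ennreal (1 / real n) * ennreal \<bar>?f m (z + v) - ?f m z\<bar>)"
      by (intro sum.cong refl ennreal_mult) auto
    finally show "ennreal \<bar>average n (z + v) - average n z\<bar> \<le> (\<Sum>m<n. ennreal (1 / real n) * ennreal \<bar>?f m (z + v) - ?f m z\<bar>)" .
  qed
  also have "\<dots> = (\<Sum>m<n. ennreal (1 / real n) * shift_dist v (?f m))"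
    unfolding shift_dist_def by (simp add: nn_integral_sum nn_integral_cmult)
  also have "\<dots> \<le> (\<Sum>m<n. ennreal (1 / real n) * c)"
    by (intro sum_mono mult_left_mono le) auto
  also have "\<dots> = c" by (rule sum_inverse_ennreal[OF n])
  finally show ?thesis .
qed

text \<open>The difference telescopes to 1/n times the n-th iterate minus the initial density, both
  of mass 1.\<close>

lemma nn_integral_transfer_average_diff_le:
  assumes n: "0 < n"
  shows "(\<integral>\<^sup>+z. ennreal \<bar>transfer (average n) z - average n z\<bar> \<partial>lborel) \<le> ennreal (2 / real n)"
proof -
  let ?f = "\<lambda>m. (transfer ^^ m) (indicator unit_square)"
  note d = densD[OF dens_transfer_pow_square]
  note [measurable] = d(1)
  have "(\<integral>\<^sup>+z. ennreal \<bar>transfer (average n) z - average n z\<bar> \<partial>lborel)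
      \<le> (\<integral>\<^sup>+z. ennreal (1 / real n) * (ennreal (?f n z) + ennreal (?f 0 z)) \<partial>lborel)"
  proof (rule nn_integral_mono)
    fix z
    have "transfer (average n) z - average n z = (\<Sum>m<n. 1 / real n * ?f (Suc m) z - 1 / real n * ?f m z)"
      unfolding average_def[abs_def] transfer_sum sum_subtractf[symmetric] by simp
    also have "\<dots> = 1 / real n * ?f n z - 1 / real n * ?f 0 z"
      by (rule sum_lessThan_telescope[where f = "\<lambda>m. 1 / real n * ?f m z"])
    also have "\<dots> = 1 / real n * (?f n z - ?f 0 z)" by (simp only: right_diff_distrib)
    finally have "\<bar>transfer (average n) z - average n z\<bar> = 1 / real n * \<bar>?f n z - ?f 0 z\<bar>"
      by (simp only: abs_mult) simp
    also have "\<dots> \<le> 1 / real n * (?f n z + ?f 0 z)"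
    proof (rule mult_left_mono)
      show "\<bar>?f n z - ?f 0 z\<bar> \<le> ?f n z + ?f 0 z"
        using d(2)[of n z] d(2)[of 0 z] by linarith
    qed simp
    finally have "ennreal \<bar>transfer (average n) z - average n z\<bar> \<le> ennreal (1 / real n * (?f n z + ?f 0 z))"
      by (rule ennreal_leI)
    also have "\<dots> = ennreal (1 / real n) * (ennreal (?f n z) + ennreal (?f 0 z))"
      using d(2)[of n z] d(2)[of 0 z] by (subst ennreal_mult) auto
    finally show "ennreal \<bar>transfer (average n) z - average n z\<bar> \<le> ennreal (1 / real n) * (ennreal (?f n z) + ennreal (?f 0 z))" .
  qed
  also have "\<dots> = ennreal (1 / real n) * ((\<integral>\<^sup>+z. ennreal (?f n z) \<partial>lborel) + (\<integral>\<^sup>+z. ennreal (?f 0 z) \<partial>lborel))"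
  proof -
    have "(\<integral>\<^sup>+z. ennreal (?f n z) + ennreal (?f 0 z) \<partial>lborel)
        = (\<integral>\<^sup>+z. ennreal (?f n z) \<partial>lborel) + (\<integral>\<^sup>+z. ennreal (?f 0 z) \<partial>lborel)"
      by (rule nn_integral_add) measurable
    moreover have "(\<integral>\<^sup>+z. ennreal (1 / real n) * (ennreal (?f n z) + ennreal (?f 0 z)) \<partial>lborel)
        = ennreal (1 / real n) * (\<integral>\<^sup>+z. ennreal (?f n z) + ennreal (?f 0 z) \<partial>lborel)"
      by (rule nn_integral_cmult) measurable
    ultimately show ?thesis by (simp only:)
  qed
  also have "\<dots> = ennreal (1 / real n) * ennreal 2"
    unfolding d(4) by simp
  also have "\<dots> = ennreal (2 / real n)" by (subst ennreal_mult[symmetric]) auto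
  finally show ?thesis .
qed

lemma dens_midpoint:
  assumes "dens g" "dens g'"
  shows "dens (\<lambda>z. (g z + g' z) / 2)"
proof -
  note d = densD[OF assms(1)] densD[OF assms(2)]
  note [measurable] = d(1) d(5)
  have "(\<integral>\<^sup>+z. ennreal ((g z + g' z) / 2) \<partial>lborel) = ennreal (1/2) * (1 + 1)"
    by (simp only: ennreal_midpoint[OF d(2) d(6)]) (simp add: nn_integral_cmult nn_integral_add d(4,8))
  also have "\<dots> = 1" by (rule ennreal_half_double)
  finally show ?thesis using d by (auto simp: dens_def)
qed

lemma average_bounded_part:
  obtains M where "0 < M" "\<And>n. 0 < n \<Longrightarrow> ennreal (1/2) \<le> (\<integral>\<^sup>+z. ennreal (min (average n z) M) \<partial>lborel)"
proof -
  have "\<exists>V\<ge>0. \<forall>n h. 0 < h \<longrightarrow> shift_dist (h *\<^sub>R e) ((transfer ^^ n) (indicator unit_square)) \<le> ennreal (V * h)" if "coord e l" for e l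
    by (rule shift_dist_transfer_pow_uniform[OF dens_unit_square that, of 2])
      (use shift_dist_unit_square[OF that] in auto)
  from this[of "(1, 0)" fst] this[of "(0, 1)" snd] obtain V1 V2 where
    V1: "0 \<le> V1" "\<And>n h. 0 < h \<Longrightarrow> shift_dist (h *\<^sub>R (1, 0)) ((transfer ^^ n) (indicator unit_square)) \<le> ennreal (V1 * h)" and
    V2: "0 \<le> V2" "\<And>n h. 0 < h \<Longrightarrow> shift_dist (h *\<^sub>R (0, 1)) ((transfer ^^ n) (indicator unit_square)) \<le> ennreal (V2 * h)"
    unfolding coord_def by blast
  \<comment> \<open>One positive constant for both axes; \<open>h\<close> is then fixed by
    \<open>2 * V * h = 1/2\<close>, so that truncating at \<open>1 / h\<^sup>2\<close> removes at
    most half of the mass.\<close>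
  define V where "V = V1 + V2 + 1"
  define h where "h = 1 / (4 * V)"
  have V: "0 < V" "V1 \<le> V" "V2 \<le> V" using V1(1) V2(1) by (auto simp: V_def)
  have h: "0 < h" "2 * V * h = 1/2" using V(1) by (auto simp: h_def)
  show thesis
  proof (rule that)
    show "0 < 1 / h\<^sup>2" using h by simp
    fix n :: nat assume n: "0 < n"
    note d = densD[OF dens_average[OF n]]
    note [measurable] = d(1)
    have "(\<integral>\<^sup>+z. ennreal (average n z - 1 / h\<^sup>2) \<partial>lborel) \<le> ennreal (2 * V * h)"
    proof (rule nn_integral_truncation_excess[OF d(1,2,4) _ _ _ h(1)])
      fix h :: real assume h: "0 < h"
      show "shift_dist (h *\<^sub>R (1, 0)) (average n) \<le> ennreal (V * h)"
        using V h by (intro shift_dist_average_le[OF n] order_trans[OF V1(2)] ennreal_leI mult_right_mono) auto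
      show "shift_dist (h *\<^sub>R (0, 1)) (average n) \<le> ennreal (V * h)"
        using V h by (intro shift_dist_average_le[OF n] order_trans[OF V2(2)] ennreal_leI mult_right_mono) auto
    qed (use V in auto)
    then have excess: "(\<integral>\<^sup>+z. ennreal (average n z - 1 / h\<^sup>2) \<partial>lborel) \<le> ennreal (1/2)" by (simp only: h(2))
    have "1 = (\<integral>\<^sup>+z. ennreal (min (average n z) (1 / h\<^sup>2)) + ennreal (average n z - 1 / h\<^sup>2) \<partial>lborel)"
      unfolding d(4)[symmetric]
    proof (rule nn_integral_cong)
      fix z
      show "ennreal (average n z) = ennreal (min (average n z) (1 / h\<^sup>2)) + ennreal (average n z - 1 / h\<^sup>2)"
        using d(2)[of z] by (cases "average n z \<le> 1 / h\<^sup>2") (auto simp: ennreal_neg simp flip: ennreal_plus)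
    qed
    also have "\<dots> = (\<integral>\<^sup>+z. ennreal (min (average n z) (1 / h\<^sup>2)) \<partial>lborel) + (\<integral>\<^sup>+z. ennreal (average n z - 1 / h\<^sup>2) \<partial>lborel)"
      by (rule nn_integral_add) measurable
    also have "\<dots> \<le> (\<integral>\<^sup>+z. ennreal (min (average n z) (1 / h\<^sup>2)) \<partial>lborel) + ennreal (1/2)"
      by (intro add_left_mono excess)
    finally have "ennreal (1/2) + ennreal (1/2) \<le> ennreal (1/2) + (\<integral>\<^sup>+z. ennreal (min (average n z) (1 / h\<^sup>2)) \<partial>lborel)"
      by (subst ennreal_plus[symmetric]) (auto simp: add.commute)
    then show "ennreal (1/2) \<le> (\<integral>\<^sup>+z. ennreal (min (average n z) (1 / h\<^sup>2)) \<partial>lborel)"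
      by (simp add: ennreal_add_left_cancel_le)
  qed
qed

subsection \<open>The invariant density\<close>

text \<open>An almost invariant density \<open>g\<close> together with a bounded part \<open>b\<close> that carries half of its mass.\<close>

definition approx :: "real \<Rightarrow> nat \<Rightarrow> (real \<times> real \<Rightarrow> real) \<Rightarrow> (real \<times> real \<Rightarrow> real) \<Rightarrow> bool" where
  "approx M n b g \<longleftrightarrow> b \<in> borel_measurable borel \<and> (\<forall>z. 0 \<le> b z \<and> b z \<le> M \<and> b z \<le> g z) \<and>
    ennreal (1/2) \<le> (\<integral>\<^sup>+z. ennreal (b z) \<partial>lborel) \<and> dens g \<and>
    (\<integral>\<^sup>+z. ennreal \<bar>transfer g z - g z\<bar> \<partial>lborel) \<le> ennreal (2 * (1/2) ^ n)"

text \<open>Each condition on the pair (b, g) is linear or convex. The bounded part is carried as a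
  separate function since the truncation of a midpoint is in general not the midpoint of the
  truncations.\<close>

lemma approx_midpoint:
  assumes "approx M n b g" "approx M n b' g'"
  shows "approx M n (\<lambda>z. (b z + b' z) / 2) (\<lambda>z. (g z + g' z) / 2)"
proof -
  note a = assms(1)[unfolded approx_def] assms(2)[unfolded approx_def]
  have [measurable]: "b \<in> borel_measurable borel" "b' \<in> borel_measurable borel"
    and dg: "dens g" "dens g'" and b0: "\<And>z. 0 \<le> b z" "\<And>z. 0 \<le> b' z"
    and bM: "\<And>z. b z \<le> M" "\<And>z. b' z \<le> M" and bg: "\<And>z. b z \<le> g z" "\<And>z. b' z \<le> g' z"
    and I: "ennreal (1/2) \<le> (\<integral>\<^sup>+z. ennreal (b z) \<partial>lborel)" "ennreal (1/2) \<le> (\<integral>\<^sup>+z. ennreal (b' z) \<partial>lborel)"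
    and D: "(\<integral>\<^sup>+z. ennreal \<bar>transfer g z - g z\<bar> \<partial>lborel) \<le> ennreal (2 * (1/2) ^ n)"
      "(\<integral>\<^sup>+z. ennreal \<bar>transfer g' z - g' z\<bar> \<partial>lborel) \<le> ennreal (2 * (1/2) ^ n)"
    using a by auto
  note [measurable] = densD(1)[OF dg(1)] densD(1)[OF dg(2)]
  have "ennreal (1/2) * (ennreal (1/2) + ennreal (1/2)) \<le> ennreal (1/2) * ((\<integral>\<^sup>+z. ennreal (b z) \<partial>lborel) + (\<integral>\<^sup>+z. ennreal (b' z) \<partial>lborel))"
    by (intro mult_left_mono add_mono I) auto
  also have "\<dots> = (\<integral>\<^sup>+z. ennreal ((b z + b' z) / 2) \<partial>lborel)"
    by (simp only: ennreal_midpoint[OF b0(1) b0(2)]) (simp add: nn_integral_cmult nn_integral_add)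
  finally have mass: "ennreal (1/2) \<le> (\<integral>\<^sup>+z. ennreal ((b z + b' z) / 2) \<partial>lborel)" unfolding ennreal_half_double .
  have "(\<integral>\<^sup>+z. ennreal \<bar>transfer (\<lambda>z. (g z + g' z) / 2) z - (g z + g' z) / 2\<bar> \<partial>lborel)
      \<le> (\<integral>\<^sup>+z. ennreal (1/2) * (ennreal \<bar>transfer g z - g z\<bar> + ennreal \<bar>transfer g' z - g' z\<bar>) \<partial>lborel)"
  proof (rule nn_integral_mono)
    fix z
    have "\<bar>transfer (\<lambda>z. (g z + g' z) / 2) z - (g z + g' z) / 2\<bar> \<le> (\<bar>transfer g z - g z\<bar> + \<bar>transfer g' z - g' z\<bar>) / 2"
      unfolding transfer_midpoint by (simp add: abs_if field_simps)
    then show "ennreal \<bar>transfer (\<lambda>z. (g z + g' z) / 2) z - (g z + g' z) / 2\<bar> \<le> ennreal (1/2) * (ennreal \<bar>transfer g z - g z\<bar> + ennreal \<bar>transfer g' z - g' z\<bar>)"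
      by (subst ennreal_midpoint[symmetric]) (auto intro: ennreal_leI)
  qed
  also have "\<dots> = ennreal (1/2) * ((\<integral>\<^sup>+z. ennreal \<bar>transfer g z - g z\<bar> \<partial>lborel) + (\<integral>\<^sup>+z. ennreal \<bar>transfer g' z - g' z\<bar> \<partial>lborel))"
    by (simp add: nn_integral_cmult nn_integral_add)
  also have "\<dots> \<le> ennreal (1/2) * (ennreal (2 * (1/2) ^ n) + ennreal (2 * (1/2) ^ n))"
    by (intro mult_left_mono add_mono D) auto
  finally have "(\<integral>\<^sup>+z. ennreal \<bar>transfer (\<lambda>z. (g z + g' z) / 2) z - (g z + g' z) / 2\<bar> \<partial>lborel) \<le> ennreal (2 * (1/2) ^ n)"
    unfolding ennreal_half_double .
  moreover have "(b z + b' z) / 2 \<le> M" "(b z + b' z) / 2 \<le> (g z + g' z) / 2" for z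
    using bM(1)[of z] bM(2)[of z] bg(1)[of z] bg(2)[of z] by auto
  ultimately show ?thesis
    unfolding approx_def using mass b0 dens_midpoint[OF dg] by auto
qed

text \<open>Only the bounded parts have to converge, so the minimisation runs over the set of
  possible b and a partner g is picked afterwards.\<close>

lemma approx_sequence:
  obtains M b g where "0 < M" "\<And>n. approx M n (b n) (g n)" "AE z in lborel. convergent (\<lambda>n. b n z)"
proof -
  obtain M where M: "0 < M" "\<And>n. 0 < n \<Longrightarrow> ennreal (1/2) \<le> (\<integral>\<^sup>+z. ennreal (min (average n z) M) \<partial>lborel)"
    by (rule average_bounded_part) (rule that; blast)
  define K where "K n = {b. \<exists>g. approx M n b g}" for n
  have sq: "integrable lborel (\<lambda>z. (b z)\<^sup>2) \<and> (\<integral>z. (b z)\<^sup>2 \<partial>lborel) \<le> M" if "b \<in> K n" for n b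
  proof -
    obtain g where a: "approx M n b g" using \<open>b \<in> K n\<close> by (auto simp: K_def)
    then have [measurable]: "b \<in> borel_measurable borel" and g: "dens g"
      and b: "\<And>z. 0 \<le> b z" "\<And>z. b z \<le> M" "\<And>z. b z \<le> g z"
      by (auto simp: approx_def)
    note [measurable] = densD(1)[OF g]
    have gi: "integrable lborel g" and gI: "(\<integral>z. g z \<partial>lborel) = 1"
      using densD[OF g] by (auto intro!: integrableI_nonneg simp: integral_eq_nn_integral)
    \<comment> \<open>One factor \<open>b z\<close> is bounded by \<open>M\<close> and the other by
      \<open>g z\<close>, which has integral 1; this gives an L2 bound for b that does not depend on
      n.\<close>
    have le: "(b z)\<^sup>2 \<le> M * g z" for z
      unfolding power2_eq_square using b M(1) by (intro mult_mono) auto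
    have bi: "integrable lborel (\<lambda>z. (b z)\<^sup>2)"
    proof (rule Bochner_Integration.integrable_bound[of lborel "\<lambda>z. M * g z"])
      show "integrable lborel (\<lambda>z. M * g z)" using gi by simp
      have "norm ((b z)\<^sup>2) \<le> norm (M * g z)" for z using le[of z] by simp
      then show "AE z in lborel. norm ((b z)\<^sup>2) \<le> norm (M * g z)" by simp
    qed measurable
    moreover have "(\<integral>z. (b z)\<^sup>2 \<partial>lborel) \<le> (\<integral>z. M * g z \<partial>lborel)"
      using gi le by (intro integral_mono bi) auto
    ultimately show ?thesis using gI by simp
  qed
  have "\<exists>b. (\<forall>n. b n \<in> K n) \<and> (AE z in lborel. convergent (\<lambda>n. b n z))"
  proof (rule midpoint_convex_AE_convergent[of K lborel M])
    fix n
    \<comment> \<open>Averages of length \<open>2 ^ n\<close> make the defects summable, as needed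
      for pointwise convergence.\<close>
    have n: "0 < (2::nat) ^ n" by simp
    note d = densD[OF dens_average[OF n]]
    have [measurable]: "average (2 ^ n) \<in> borel_measurable borel" by (rule d(1))
    have "(\<integral>\<^sup>+z. ennreal \<bar>transfer (average (2 ^ n)) z - average (2 ^ n) z\<bar> \<partial>lborel) \<le> ennreal (2 * (1/2) ^ n)"
      using nn_integral_transfer_average_diff_le[OF n] by (simp add: power_one_over)
    then have "approx M n (\<lambda>z. min (average (2 ^ n) z) M) (average (2 ^ n))"
      unfolding approx_def using dens_average[OF n] M(1) M(2)[OF n] d(2) by auto
    then show "K n \<noteq> {}" by (auto simp: K_def)
  next
    show "decseq K"
    proof (rule decseq_SucI)
      fix n
      have "ennreal (2 * (1/2) ^ Suc n) \<le> ennreal (2 * (1/2) ^ n)" by (rule ennreal_leI) simp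
      then show "K (Suc n) \<subseteq> K n" unfolding K_def approx_def using order_trans by blast
    qed
  next
    show "b \<in> borel_measurable lborel" if "b \<in> K n" for n b using that by (auto simp: K_def approx_def)
    show "(\<lambda>x. (b x + b' x) / 2) \<in> K n" if "b \<in> K n" "b' \<in> K n" for n b b'
      using that approx_midpoint unfolding K_def by blast
  qed (use sq in blast)+
  then obtain b where b: "\<And>n. b n \<in> K n" "AE z in lborel. convergent (\<lambda>n. b n z)" by blast
  then obtain g where "\<And>n. approx M n (b n) (g n)" unfolding K_def mem_Collect_eq by metis
  then show thesis using that M(1) b(2) by blast
qed

text \<open>This is Fatou's lemma, with the sum over the branches read as an integral over a
  weighted three-point space.\<close>

lemma transfer_ennreal_liminf_le: "transfer_ennreal (\<lambda>z. liminf (\<lambda>n. f n z)) z \<le> liminf (\<lambda>n. transfer_ennreal (f n) z)"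
proof -
  let ?M = "point_measure {..<3} (\<lambda>i. ennreal (weight i (branch i z) / \<beta>\<^sup>2))"
  have eq: "transfer_ennreal h z = (\<integral>\<^sup>+i. h (branch i z) \<partial>?M)" for h
    unfolding transfer_ennreal_def by (subst nn_integral_point_measure_finite) auto
  show ?thesis unfolding eq by (rule nn_integral_liminf) (simp add: point_measure_def)
qed

lemma Sb_measurable [measurable]: "Sb \<beta> \<in> sets borel"
  unfolding Sb_def case_prod_beta by measurable

lemma emeasure_Sb_finite: "emeasure lborel (Sb \<beta>) < \<infinity>"
proof -
  have "Sb \<beta> \<subseteq> cbox (0, 0) (r, r)" by (auto simp: Sb_def)
  then have "emeasure lborel (Sb \<beta>) \<le> emeasure lborel (cbox (0, 0) (r, r))"
    by (rule emeasure_mono) simp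
  then show ?thesis using emeasure_lborel_cbox_finite le_less_trans by blast
qed

lemma exists_invariant_density:
  obtains \<kappa> where "\<kappa> \<in> borel_measurable borel" "\<And>z. z \<notin> Sb \<beta> \<Longrightarrow> \<kappa> z = 0"
    "(\<integral>\<^sup>+z. \<kappa> z \<partial>lborel) = 1" "AE z in lborel. transfer_ennreal \<kappa> z = \<kappa> z"
proof -
  obtain M b g where M: "0 < M" and ap: "\<And>n. approx M n (b n) (g n)"
    and conv: "AE z in lborel. convergent (\<lambda>n. b n z)"
    by (rule approx_sequence) (rule that)
  have bm[measurable]: "b n \<in> borel_measurable borel" and g: "dens (g n)"
    and b0: "0 \<le> b n z" and bM: "b n z \<le> M" and bg: "b n z \<le> g n z"
    and mass: "ennreal (1/2) \<le> (\<integral>\<^sup>+z. ennreal (b n z) \<partial>lborel)"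
    and diff: "(\<integral>\<^sup>+z. ennreal \<bar>transfer (g n) z - g n z\<bar> \<partial>lborel) \<le> ennreal (2 * (1/2) ^ n)" for n z
    using ap[of n] unfolding approx_def by blast+
  have gm[measurable]: "g n \<in> borel_measurable borel" for n by (rule densD(1)[OF g])
  have g0: "0 \<le> g n z" for n z by (rule densD(2)[OF g])
  define k where "k z = liminf (\<lambda>n. ennreal (g n z))" for z
  have km[measurable]: "k \<in> borel_measurable borel" unfolding k_def[abs_def] by measurable
  have kS: "k z = 0" if "z \<notin> Sb \<beta>" for z
    unfolding k_def using densD(3)[OF g that] by (simp add: Liminf_const)
  have "(\<integral>\<^sup>+z. k z \<partial>lborel) \<le> liminf (\<lambda>n. \<integral>\<^sup>+z. ennreal (g n z) \<partial>lborel)"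
    unfolding k_def by (rule nn_integral_liminf) measurable
  also have "\<dots> = 1" by (simp add: densD(4)[OF g] Liminf_const)
  finally have k_le: "(\<integral>\<^sup>+z. k z \<partial>lborel) \<le> 1" .
  have k_ge: "ennreal (1/2) \<le> (\<integral>\<^sup>+z. k z \<partial>lborel)"
  proof -
    \<comment> \<open>Here the bounded parts are needed: they are dominated by \<open>M\<close> on
      the triangle, so their limit keeps mass at least 1/2, and it lies below \<open>k\<close>. The
      densities \<open>g n\<close> themselves need not converge.\<close>
    define u where "u z = ennreal (lim (\<lambda>n. b n z))" for z
    have um[measurable]: "u \<in> borel_measurable borel" unfolding u_def[abs_def] by measurable
    have lim: "AE z in lborel. (\<lambda>n. ennreal (b n z)) \<longlonglongrightarrow> u z"
      using conv by eventually_elim (simp add: u_def convergent_LIMSEQ_iff)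
    have "(\<lambda>n. \<integral>\<^sup>+z. ennreal (b n z) \<partial>lborel) \<longlonglongrightarrow> (\<integral>\<^sup>+z. u z \<partial>lborel)"
    proof (rule nn_integral_dominated_convergence[where w = "\<lambda>z. ennreal M * indicator (Sb \<beta>) z", OF _ _ _ _ _ lim])
      show "AE z in lborel. ennreal (b n z) \<le> ennreal M * indicator (Sb \<beta>) z" for n
      proof (rule AE_I2)
        fix z
        show "ennreal (b n z) \<le> ennreal M * indicator (Sb \<beta>) z"
          using bM[of n z] bg[of n z] densD(3)[OF g, of z n] by (cases "z \<in> Sb \<beta>") (auto intro: ennreal_leI simp: ennreal_neg)
      qed
      show "(\<integral>\<^sup>+z. ennreal M * indicator (Sb \<beta>) z \<partial>lborel) < \<infinity>"
        using emeasure_Sb_finite by (simp add: nn_integral_cmult_indicator ennreal_mult_less_top)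
    qed measurable
    then have "ennreal (1/2) \<le> (\<integral>\<^sup>+z. u z \<partial>lborel)"
      by (rule LIMSEQ_le_const) (use mass in auto)
    also have "\<dots> \<le> (\<integral>\<^sup>+z. k z \<partial>lborel)"
    proof (rule nn_integral_mono_AE)
      show "AE z in lborel. u z \<le> k z"
        using lim
      proof eventually_elim
        case (elim z)
        have "u z = liminf (\<lambda>n. ennreal (b n z))" using lim_imp_Liminf[OF _ elim] by simp
        also have "\<dots> \<le> k z" unfolding k_def by (intro Liminf_mono always_eventually allI ennreal_leI bg)
        finally show ?case .
      qed
    qed
    finally show ?thesis .
  qed
  have "AE z in lborel. (\<lambda>n. transfer (g n) z - g n z) \<longlonglongrightarrow> 0"
    by (rule AE_tendsto_0_of_summable[OF _ diff]) (auto intro!: summable_mult summable_geometric)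
  then have sub: "AE z in lborel. transfer_ennreal k z \<le> k z"
  proof eventually_elim
    case (elim z)
    have "transfer_ennreal k z \<le> liminf (\<lambda>n. transfer_ennreal (\<lambda>z. ennreal (g n z)) z)"
      unfolding k_def[abs_def] by (rule transfer_ennreal_liminf_le)
    also have "\<dots> = liminf (\<lambda>n. ennreal (transfer (g n) z))" by (simp add: transfer_ennreal_eq g0)
    also have "\<dots> \<le> k z"
      unfolding k_def by (rule liminf_ennreal_le_of_diff_tendsto_0[OF g0 elim])
    finally show ?case .
  qed
  have kfin: "(\<integral>\<^sup>+z. k z \<partial>lborel) \<noteq> \<infinity>" using k_le by (auto simp: top_unique)
  have "(\<integral>\<^sup>+z. k z - transfer_ennreal k z \<partial>lborel) = (\<integral>\<^sup>+z. k z \<partial>lborel) - (\<integral>\<^sup>+z. transfer_ennreal k z \<partial>lborel)"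
    by (rule nn_integral_diff) (use sub kfin nn_integral_transfer_ennreal[OF km] in auto)
  also have "\<dots> = 0" using kfin by (simp add: nn_integral_transfer_ennreal[OF km])
  \<comment> \<open>Subtraction is truncated in the extended nonnegative reals, so a zero difference
    gives only that \<open>k\<close> is at most its transfer; equality needs \<open>sub\<close>
    again.\<close>
  finally have "AE z in lborel. k z - transfer_ennreal k z = 0"
    by (subst (asm) nn_integral_0_iff_AE) auto
  then have inv: "AE z in lborel. transfer_ennreal k z = k z"
    using sub by eventually_elim (auto simp: ennreal_minus_eq_0 intro: antisym)
  \<comment> \<open>The mass of \<open>k\<close> is only known to lie between 1/2 and 1, hence the
    normalisation.\<close>
  define c where "c = (\<integral>\<^sup>+z. k z \<partial>lborel)"
  have c: "c \<noteq> 0" "c \<noteq> \<infinity>" using k_ge kfin by (auto simp: c_def)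
  show thesis
  proof (rule that[of "\<lambda>z. k z / c"])
    show "(\<integral>\<^sup>+z. k z / c \<partial>lborel) = 1"
      using c by (simp add: nn_integral_divide c_def[symmetric] ennreal_divide_self less_top)
    have "transfer_ennreal (\<lambda>z. k z / c) z = transfer_ennreal k z / c" for z
      by (simp add: transfer_ennreal_def divide_ennreal_def sum_distrib_right mult.assoc)
    then show "AE z in lborel. transfer_ennreal (\<lambda>z. k z / c) z = k z / c"
      using inv by auto
  qed (auto simp: kS)
qed

end

section \<open>From the invariant density to the invariant measure\<close>

theorem theorem5p3:
  fixes \<beta> p s t :: real
  assumes "1 < \<beta>" and "\<beta> < 3/2"
    and "0 < p" and "p < 1" and "0 < s" and "0 < t" and "s + t < 1"
  shows "\<exists>\<mu> :: (real \<times> real) measure.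
           sets \<mu> = sets (borel :: (real \<times> real) measure) \<and>
           prob_space \<mu> \<and>
           emeasure \<mu> (UNIV - Sb \<beta>) = 0 \<and>
           absolutely_continuous lborel \<mu> \<and>
           (\<forall>A \<in> sets (borel :: (real \<times> real) measure). A \<subseteq> Sb \<beta> \<longrightarrow>
              emeasure \<mu> A =
                (\<Sum>k\<in>{1..6::nat}. ennreal (pk p s t k) * emeasure \<mu> (tau \<beta> k -` A \<inter> Sb \<beta>)))"
proof -
  interpret random_beta \<beta> p s t using assms by unfold_locales auto
  obtain \<kappa> where [measurable]: "\<kappa> \<in> borel_measurable borel" and S: "\<And>z. z \<notin> Sb \<beta> \<Longrightarrow> \<kappa> z = 0"
    and mass: "(\<integral>\<^sup>+z. \<kappa> z \<partial>lborel) = 1" and inv: "AE z in lborel. transfer_ennreal \<kappa> z = \<kappa> z"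
    by (rule exists_invariant_density) (rule that)
  define \<mu> where "\<mu> = density lborel \<kappa>"
  have em: "emeasure \<mu> A = (\<integral>\<^sup>+z. indicator A z * \<kappa> z \<partial>lborel)" if "A \<in> sets borel" for A
    unfolding \<mu>_def using that by (subst emeasure_density) (auto simp: mult.commute)
  have sets: "sets \<mu> = sets borel" by (simp add: \<mu>_def)
  have prob: "prob_space \<mu>"
    by (rule prob_spaceI) (use mass em[of UNIV] in \<open>simp add: \<mu>_def\<close>)
  have null: "emeasure \<mu> (UNIV - Sb \<beta>) = 0"
  proof -
    have "(\<lambda>z. indicator (UNIV - Sb \<beta>) z * \<kappa> z) = (\<lambda>_. 0)"
    proof (rule ext)
      show "indicator (UNIV - Sb \<beta>) z * \<kappa> z = 0" for z
        using S[of z] by (cases "z \<in> Sb \<beta>") auto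
    qed
    moreover have "UNIV - Sb \<beta> \<in> sets borel" by measurable
    ultimately show ?thesis using em[of "UNIV - Sb \<beta>"] by (simp only: nn_integral_const) simp
  qed
  have ac: "absolutely_continuous lborel \<mu>"
    unfolding \<mu>_def by (rule absolutely_continuousI_density) simp
  have "emeasure \<mu> A = (\<Sum>k\<in>{1..6::nat}. ennreal (pk p s t k) * emeasure \<mu> (tau \<beta> k -` A \<inter> Sb \<beta>))"
    if [measurable]: "A \<in> sets borel" for A
  proof -
    have pre[measurable]: "tau \<beta> k -` A \<inter> Sb \<beta> \<in> sets borel" for k
      using measurable_sets[OF tau_measurable[of k] that] by auto
    have "emeasure \<mu> A = (\<integral>\<^sup>+z. indicator A z * \<kappa> z \<partial>lborel)" by (rule em[OF that])
    also have "\<dots> = (\<integral>\<^sup>+z. indicator A z * transfer_ennreal \<kappa> z \<partial>lborel)"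
      by (rule nn_integral_cong_AE) (use inv in auto)
    also have "\<dots> = (\<integral>\<^sup>+u. (\<Sum>i<3. ennreal (weight i u) * indicator A (\<beta> *\<^sub>R u - qv i)) * \<kappa> u \<partial>lborel)"
      by (rule transfer_ennreal_duality) measurable
    also have "\<dots> = (\<integral>\<^sup>+u. (\<Sum>k\<in>{1..6}. ennreal (pk p s t k) * (indicator (tau \<beta> k -` A \<inter> Sb \<beta>) u * \<kappa> u)) \<partial>lborel)"
    proof (rule nn_integral_cong)
      fix u
      have "(\<Sum>i<3. ennreal (weight i u) * indicator A (\<beta> *\<^sub>R u - qv i)) * \<kappa> u
          = (\<Sum>k\<in>{1..6}. ennreal (pk p s t k) * (indicator A (tau \<beta> k u) * \<kappa> u))"
        using sum_weight_mult[of u "\<lambda>q. indicator A (\<beta> *\<^sub>R u - q)"]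
        by (simp only: sum_distrib_right mult.assoc tau_def)
      \<comment> \<open>Since \<open>\<kappa>\<close> vanishes off the triangle, intersecting the
        preimages with it changes nothing.\<close>
      also have "\<dots> = (\<Sum>k\<in>{1..6}. ennreal (pk p s t k) * (indicator (tau \<beta> k -` A \<inter> Sb \<beta>) u * \<kappa> u))"
        using S[of u] by (intro sum.cong refl) (auto simp: indicator_def)
      finally show "(\<Sum>i<3. ennreal (weight i u) * indicator A (\<beta> *\<^sub>R u - qv i)) * \<kappa> u
          = (\<Sum>k\<in>{1..6}. ennreal (pk p s t k) * (indicator (tau \<beta> k -` A \<inter> Sb \<beta>) u * \<kappa> u))" .
    qed
    also have "\<dots> = (\<Sum>k\<in>{1..6}. ennreal (pk p s t k) * emeasure \<mu> (tau \<beta> k -` A \<inter> Sb \<beta>))"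
      unfolding em[OF pre] by (simp add: nn_integral_sum nn_integral_cmult)
    finally show ?thesis .
  qed
  then show ?thesis using sets prob null ac by blast
qed

end
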